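(* Let $\Bbbk$ be an algebraically closed field, let $A$ be the Kronecker algebra over $\Bbbk$, and let $M$ be a finite-dimensional $A$-module with dimension vector $(d_1,d_2)$. With the integer $d$ and the finite set $\Lambda\subseteq\Bbbk$ associated to $M$ as described in the context, set $$S_M:=\{P_i,\ I_j,\ R_k(\lambda)\mid 1\le i\le d_2,\ 1\le j\le d_1,\ 1\le k\le d,\ \lambda\in\Lambda\cup\{\infty\}\}.$$ Then $S_M$ is a finite set with $\operatorname{supp}(\boldsymbol{d}_M)\subseteq S_M\subseteq\mathcal{L}$.
   Context: The Kronecker algebra $A$ is the path algebra over $\Bbbk$ of the quiver with two vertices $1,2$ and two arrows $\alpha,\beta\colon1\to2$. Finite-dimensional $A$-modules are identified with representations $M$ of this quiver; with $\underline{\dim}M=(\dim M(1),\dim M(2))=(d_1,d_2)$ one writes $M=(M(\alpha),M(\beta))$ with $d_2\times d_1$ matrices (empty matrices allowed). A complete list $\mathcal{L}$ of representatives of isoclasses of indecomposable $A$-modules is given, for $n\ge1$ and $\lambda\in\Bbbk$, by $P_n=\left(\begin{bmatrix}E_{n-1}\\ 0\end{bmatrix},\begin{bmatrix}0\\ E_{n-1}\end{bmatrix}\right)$ (preprojective; matrices of size $n\times(n-1)$), $I_n=([E_{n-1}\ 0],[0\ E_{n-1}])$ (preinjective; size $(n-1)\times n$), $R_n(\lambda)=(E_n,J_n(\lambda))$ and $R_n(\infty)=(J_n(0),E_n)$ (regular), where $E_n$ is the identity matrix and $J_n(\lambda)$ the (upper triangular) Jordan cell of size $n$ with eigenvalue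 $\lambda$. Convention: $P_0=I_0=R_0(\infty)=0$. For an $A$-module $M$, $\boldsymbol{d}_M\colon\mathcal{L}\to\mathbb{N}_0$ is the unique map with $M\cong\bigoplus_{L\in\mathcal{L}}L^{(\boldsymbol{d}_M(L))}$, and $\operatorname{supp}(\boldsymbol{d}_M)=\{L\in\mathcal{L}\mid\boldsymbol{d}_M(L)\ne0\}$. For modules $N,U$, the trace is $\mathrm{Tr}_N(U)=\sum\{\operatorname{Im}f\mid f\in\operatorname{Hom}_A(U,N)\}$ and the reject is $\mathrm{Rej}_N(U)=\bigcap\{\operatorname{Ker}f\mid f\in\operatorname{Hom}_A(N,U)\}$. Definition of $d$ and $\Lambda$. Let $K=\mathrm{Rej}_M(P_{d_2})$ and $R_M=K/\mathrm{Tr}_K(I_{d_1})$. The module $R_M$ is isomorphic to a direct sum of regular indecomposables, so $R_M(\alpha),R_M(\beta)$ are square matrices; $d$ denotes their size, i.e. $\underline{\dim}R_M=(d,d)$. Put $R(\infty)=\mathrm{Tr}_{R_M}(R_d(\infty))$. Then $R_M=R(\infty)\oplus R'$ for a submodule $R'=(X',Y')$ of $R_M$ having no direct summand isomorphic to any $R_n(\infty)$ (one has $R'=\mathrm{Rej}_{R_M}(R_d(\infty))$). The matrix $X'$ is invertible, so $R'\cong(E_l,(X')^{-1}Y')$ for some $l\le d$; $\Lambda$ is the set of eigenvalues of $(X')^{-1}Y'$. *)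

theory Defs
  imports
    "Jordan_Normal_Form.Jordan_Normal_Form"
    "Jordan_Normal_Form.VS_Connect"
    "HOL-Algebra.AbelCoset"
begin

section \<open>Representations of the Kronecker quiver\<close>

text \<open>
  The two vertex spaces are HOL-Algebra module records over \<^const>\<open>class_ring\<close>; the fields
  \<^const>\<open>mult\<close> and \<^const>\<open>one\<close> of such a record play no role for modules and get dummy values below.
  The values of the two arrows outside the carrier are irrelevant.
\<close>

record ('k, 'v, 'w) krep =
  V1 :: "('k, 'v) module"
  V2 :: "('k, 'w) module"
  arr_a :: "'v \<Rightarrow> 'w"
  arr_b :: "'v \<Rightarrow> 'w"

definition krep_dim1 :: "('k::field, 'v, 'w) krep \<Rightarrow> nat" where
  "krep_dim1 M = vectorspace.dim class_ring (V1 M)"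

definition krep_dim2 :: "('k::field, 'v, 'w) krep \<Rightarrow> nat" where
  "krep_dim2 M = vectorspace.dim class_ring (V2 M)"

definition fin_dim_krep :: "('k::field, 'v, 'w) krep \<Rightarrow> bool" where
  "fin_dim_krep M \<longleftrightarrow>
     linear_map class_ring (V1 M) (V2 M) (arr_a M) \<and>
     linear_map class_ring (V1 M) (V2 M) (arr_b M) \<and>
     vectorspace.fin_dim class_ring (V1 M) \<and>
     vectorspace.fin_dim class_ring (V2 M)"

definition krep_hom ::
  "('k::field, 'v, 'w) krep \<Rightarrow> ('k, 'x, 'y) krep \<Rightarrow> (('v \<Rightarrow> 'x) \<times> ('w \<Rightarrow> 'y)) set" where
  "krep_hom M N = {(f, g).
     f \<in> module_hom class_ring (V1 M) (V1 N) \<and>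
     g \<in> module_hom class_ring (V2 M) (V2 N) \<and>
     (\<forall>x \<in> carrier (V1 M). g (arr_a M x) = arr_a N (f x) \<and> g (arr_b M x) = arr_b N (f x))}"

definition krep_iso :: "('k::field, 'v, 'w) krep \<Rightarrow> ('k, 'x, 'y) krep \<Rightarrow> bool" where
  "krep_iso M N \<longleftrightarrow> (\<exists>(f, g) \<in> krep_hom M N.
     bij_betw f (carrier (V1 M)) (carrier (V1 N)) \<and>
     bij_betw g (carrier (V2 M)) (carrier (V2 N)))"


section \<open>Subrepresentations, quotients and direct sums\<close>

definition krep_sub ::
  "('k::field, 'v, 'w) krep \<Rightarrow> 'v set \<Rightarrow> 'w set \<Rightarrow> ('k, 'v, 'w) krep" where
  "krep_sub M S T = M\<lparr>V1 := (V1 M)\<lparr>carrier := S\<rparr>, V2 := (V2 M)\<lparr>carrier := T\<rparr>\<rparr>"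

definition module_quot :: "('k, 'v) module \<Rightarrow> 'v set \<Rightarrow> ('k, 'v set) module" where
  "module_quot V S =
     \<lparr>carrier = a_rcosets\<^bsub>V\<^esub> S, mult = (\<lambda>_ _. S), one = S, zero = S, add = set_add V,
      smult = (\<lambda>c C. \<Union>x\<in>C. S +>\<^bsub>V\<^esub> (c \<odot>\<^bsub>V\<^esub> x))\<rparr>"

text \<open>In \<open>krep_quot M N\<close>, the second argument is a subrepresentation of the first.\<close>

definition krep_quot ::
  "('k::field, 'v, 'w) krep \<Rightarrow> ('k, 'v, 'w) krep \<Rightarrow> ('k, 'v set, 'w set) krep" where
  "krep_quot M N =
     \<lparr>V1 = module_quot (V1 M) (carrier (V1 N)),
      V2 = module_quot (V2 M) (carrier (V2 N)),
      arr_a = (\<lambda>C. \<Union>x\<in>C. carrier (V2 N) +>\<^bsub>V2 M\<^esub> arr_a M x),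
      arr_b = (\<lambda>C. \<Union>x\<in>C. carrier (V2 N) +>\<^bsub>V2 M\<^esub> arr_b M x)\<rparr>"

definition module_dsum :: "'i set \<Rightarrow> ('i \<Rightarrow> ('k, 'v) module) \<Rightarrow> ('k, 'i \<Rightarrow> 'v) module" where
  "module_dsum J V =
     \<lparr>carrier = {x \<in> \<Pi>\<^sub>E i\<in>J. carrier (V i). finite {i \<in> J. x i \<noteq> \<zero>\<^bsub>V i\<^esub>}},
      mult = (\<lambda>_ _. \<lambda>i\<in>J. \<zero>\<^bsub>V i\<^esub>), one = (\<lambda>i\<in>J. \<zero>\<^bsub>V i\<^esub>),
      zero = (\<lambda>i\<in>J. \<zero>\<^bsub>V i\<^esub>),
      add = (\<lambda>x y. \<lambda>i\<in>J. x i \<oplus>\<^bsub>V i\<^esub> y i),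
      smult = (\<lambda>c x. \<lambda>i\<in>J. c \<odot>\<^bsub>V i\<^esub> x i)\<rparr>"

definition krep_dsum ::
  "'i set \<Rightarrow> ('i \<Rightarrow> ('k::field, 'v, 'w) krep) \<Rightarrow> ('k, 'i \<Rightarrow> 'v, 'i \<Rightarrow> 'w) krep" where
  "krep_dsum J M =
     \<lparr>V1 = module_dsum J (\<lambda>i. V1 (M i)),
      V2 = module_dsum J (\<lambda>i. V2 (M i)),
      arr_a = (\<lambda>x. \<lambda>i\<in>J. arr_a (M i) (x i)),
      arr_b = (\<lambda>x. \<lambda>i\<in>J. arr_b (M i) (x i))\<rparr>"


section \<open>Trace and reject\<close>

text \<open>
  The trace \<open>Tr\<^sub>N(U)\<close>: a sum of submodules is the span of their union.
\<close>

definition krep_trace ::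
  "('k::field, 'v, 'w) krep \<Rightarrow> ('k, 'x, 'y) krep \<Rightarrow> ('k, 'v, 'w) krep" where
  "krep_trace N U = krep_sub N
     (module.span class_ring (V1 N) (\<Union>(f, g) \<in> krep_hom U N. f ` carrier (V1 U)))
     (module.span class_ring (V2 N) (\<Union>(f, g) \<in> krep_hom U N. g ` carrier (V2 U)))"

definition krep_reject ::
  "('k::field, 'v, 'w) krep \<Rightarrow> ('k, 'x, 'y) krep \<Rightarrow> ('k, 'v, 'w) krep" where
  "krep_reject N U = krep_sub N
     {x \<in> carrier (V1 N). \<forall>(f, g) \<in> krep_hom N U. f x = \<zero>\<^bsub>V1 U\<^esub>}
     {y \<in> carrier (V2 N). \<forall>(f, g) \<in> krep_hom N U. g y = \<zero>\<^bsub>V2 U\<^esub>}"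


section \<open>The indecomposable representations\<close>

text \<open>
  A pair of \<open>m \<times> n\<close> matrices is read as the representation with dimension vector \<open>(n, m)\<close>;
  matrices without rows or without columns still carry both of their dimensions.
\<close>

definition mat_krep :: "'k::field mat \<times> 'k mat \<Rightarrow> ('k, 'k vec, 'k vec) krep" where
  "mat_krep = (\<lambda>(A, B).
     \<lparr>V1 = module_vec TYPE('k) (dim_col A), V2 = module_vec TYPE('k) (dim_row A),
      arr_a = (\<lambda>v. A *\<^sub>v v), arr_b = (\<lambda>v. B *\<^sub>v v)\<rparr>)"

text \<open>
  By truncated subtraction, index \<open>0\<close> yields \<open>0 \<times> 0\<close> matrices, i.e. \<open>P\<^sub>0 = I\<^sub>0 = R\<^sub>0(\<infinity>) = 0\<close>.
  The parameter \<^const>\<open>None\<close> of \<open>kron_R\<close> stands for \<open>\<infinity>\<close>.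
\<close>

definition kron_P :: "nat \<Rightarrow> 'k::field mat \<times> 'k mat" where
  "kron_P n = (mat n (n - 1) (\<lambda>(i, j). if i = j then 1 else 0),
               mat n (n - 1) (\<lambda>(i, j). if i = Suc j then 1 else 0))"

definition kron_I :: "nat \<Rightarrow> 'k::field mat \<times> 'k mat" where
  "kron_I n = (mat (n - 1) n (\<lambda>(i, j). if i = j then 1 else 0),
               mat (n - 1) n (\<lambda>(i, j). if Suc i = j then 1 else 0))"

fun kron_R :: "nat \<Rightarrow> 'k::field option \<Rightarrow> 'k mat \<times> 'k mat" where
  "kron_R n (Some a) = (1\<^sub>m n, jordan_block n a)"
| "kron_R n None = (jordan_block n 0, 1\<^sub>m n)"

definition kron_list :: "('k::field mat \<times> 'k mat) set" where
  "kron_list = {kron_P n | n. 1 \<le> n} \<union> {kron_I n | n. 1 \<le> n} \<union> {kron_R n \<mu> | n \<mu>. 1 \<le> n}"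


section \<open>Multiplicities\<close>

text \<open>
  \<open>is_multiplicity M d\<close> is the property defining \<open>d = \<^bold>d\<^sub>M\<close>, namely that \<open>M\<close> is isomorphic to the
  direct sum of \<open>d L\<close> copies of each \<open>L\<close> in the list. The values of \<open>d\<close> outside \<^const>\<open>kron_list\<close>
  are irrelevant.
\<close>

definition is_multiplicity ::
  "('k::field, 'v, 'w) krep \<Rightarrow> ('k mat \<times> 'k mat \<Rightarrow> nat) \<Rightarrow> bool" where
  "is_multiplicity M d \<longleftrightarrow>
     krep_iso M (krep_dsum {(L, i). L \<in> kron_list \<and> i < d L} (\<lambda>(L, i). mat_krep L))"

definition kron_supp :: "('k::field mat \<times> 'k mat \<Rightarrow> nat) \<Rightarrow> ('k mat \<times> 'k mat) set" where
  "kron_supp d = {L \<in> kron_list. d L \<noteq> 0}"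


section \<open>The regular part and the set of candidates\<close>

definition kron_K :: "('k::field, 'v, 'w) krep \<Rightarrow> ('k, 'v, 'w) krep" where
  "kron_K M = krep_reject M (mat_krep (kron_P (krep_dim2 M)))"

definition reg_part :: "('k::field, 'v, 'w) krep \<Rightarrow> ('k, 'v set, 'w set) krep" where
  "reg_part M =
     krep_quot (kron_K M) (krep_trace (kron_K M) (mat_krep (kron_I (krep_dim1 M))))"

text \<open>As \<open>R\<^sub>M\<close> is regular, both components of its dimension vector equal \<open>d\<close>.\<close>

definition reg_size :: "('k::field, 'v, 'w) krep \<Rightarrow> nat" where
  "reg_size M = krep_dim1 (reg_part M)"

definition fin_reg_part :: "('k::field, 'v, 'w) krep \<Rightarrow> ('k, 'v set, 'w set) krep" where
  "fin_reg_part M = krep_reject (reg_part M) (mat_krep (kron_R (reg_size M) None))"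

text \<open>
  Here \<open>(X, Y)\<close> is a matrix form of \<open>R'\<close> and \<open>Z = X\<^sup>-\<^sup>1\<close>. A change of bases in \<open>R'\<close> replaces
  \<open>X\<^sup>-\<^sup>1 Y\<close> by a similar matrix, so every matrix form contributes the same eigenvalues.
\<close>

definition Lambda :: "('k::field, 'v, 'w) krep \<Rightarrow> 'k set" where
  "Lambda M = {\<mu>. \<exists>l X Y Z.
     X \<in> carrier_mat l l \<and> Y \<in> carrier_mat l l \<and> Z \<in> carrier_mat l l \<and>
     krep_iso (fin_reg_part M) (mat_krep (X, Y)) \<and>
     inverts_mat X Z \<and> inverts_mat Z X \<and>
     eigenvalue (Z * Y) \<mu>}"

definition S_set :: "('k::field, 'v, 'w) krep \<Rightarrow> ('k mat \<times> 'k mat) set" where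
  "S_set M =
     {kron_P i | i. 1 \<le> i \<and> i \<le> krep_dim2 M} \<union>
     {kron_I j | j. 1 \<le> j \<and> j \<le> krep_dim1 M} \<union>
     {kron_R k \<mu> | k \<mu>. 1 \<le> k \<and> k \<le> reg_size M \<and> \<mu> \<in> Some ` Lambda M \<union> {None}}"

end

theory Submission
  imports Defs
begin

text \<open>
  The decomposition of \<open>M\<close> into indecomposables is handed to us by the multiplicity function, so no
  classification is needed; one only has to follow the given summands through the construction.
  \<open>Hom(N, P\<^sub>n) = 0\<close> as soon as one of the two arrows of \<open>N\<close> is surjective, and \<open>P\<^sub>i\<close>
  embeds into \<open>P\<^sub>n\<close> for \<open>i \<le> n\<close>, so the first reject removes exactly the preprojective summands.
  Dually, \<open>Hom(I\<^sub>n, N) = 0\<close> as soon as one of the arrows of \<open>N\<close> is injective, and \<open>I\<^sub>n\<close>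
  maps onto \<open>I\<^sub>j\<close> for \<open>j \<le> n\<close>, so the trace removes the preinjective summands. Finally
  \<open>Hom(N, R\<^sub>n(\<infinity>)) = 0\<close> if \<open>\<alpha>\<close> is surjective on \<open>N\<close>, so the last reject leaves the sum of the
  \<open>R\<^sub>k(\<lambda>)\<close> with finite \<open>\<lambda>\<close>. There \<open>\<alpha>\<close> is bijective, and the first basis vector of a summand
  \<open>R\<^sub>k(\<lambda>)\<close> satisfies \<open>\<beta> x = \<lambda> \<alpha> x\<close>, which puts \<open>\<lambda>\<close> into \<open>\<Lambda>\<close>. The bounds on the indices
  hold because each summand is a direct summand at the stage where it survives.
\<close>

section \<open>Linear algebra\<close>

text \<open>Finiteness of S_M is claimed for every M, with no multiplicity function at hand, so it
  cannot rest on a decomposition. It rests on two facts: rejects, traces and quotients stay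
  finite-dimensional in general, and \<mu> is an eigenvalue of X^-1 Y exactly when \<beta> x = \<mu>
  \<alpha> x for some x \<noteq> 0. The summands of a given decomposition are indexed by pairs of a
  label and a copy number, and this index set is not known to be finite in advance. Hence elements
  are handled through coordinates that separate points and through an induction over finite
  supports. Each stage is either a subspace where some coordinates vanish or the quotient by one;
  both keep the labels, so one locale serves for M, K, R_M and R'. Which arrow yields a vanishing
  Hom depends on the summand: at R_n(\<infinity>) the arrow \<alpha> is nilpotent and \<beta> is the
  identity, while at R_n(\<lambda>) only \<alpha> is bijective for every \<lambda>.\<close>

lemma class_module_hom_iff:
  "f \<in> module_hom class_ring V W \<longleftrightarrow>
    f \<in> carrier V \<rightarrow> carrier W \<and>
    (\<forall>x\<in>carrier V. \<forall>y\<in>carrier V. f (x \<oplus>\<^bsub>V\<^esub> y) = f x \<oplus>\<^bsub>W\<^esub> f y) \<and>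
    (\<forall>c. \<forall>x\<in>carrier V. f (c \<odot>\<^bsub>V\<^esub> x) = c \<odot>\<^bsub>W\<^esub> f x)"
  by (auto simp: module_hom_def)

lemma linear_mapI:
  "vectorspace K V \<Longrightarrow> vectorspace K W \<Longrightarrow> f \<in> module_hom K V W \<Longrightarrow> linear_map K V W f"
  by (simp add: linear_map_def mod_hom_def mod_hom_axioms_def vectorspace_def)

lemma linear_mapD:
  assumes "linear_map K V W f"
  shows "vectorspace K V" "vectorspace K W" "f \<in> module_hom K V W"
  using assms by (auto simp: linear_map_def mod_hom_def mod_hom_axioms_def)

lemma module_hom_comp:
  assumes "f \<in> module_hom class_ring U V" "g \<in> module_hom class_ring V W"
  shows "(\<lambda>x. g (f x)) \<in> module_hom class_ring U W"
  using assms unfolding class_module_hom_iff by (auto simp: Pi_iff)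

lemma module_hom_inv_into:
  assumes V: "vectorspace class_ring V"
    and f: "f \<in> module_hom class_ring V W" and bij: "bij_betw f (carrier V) (carrier W)"
  shows "inv_into (carrier V) f \<in> module_hom class_ring W V"
proof -
  interpret vectorspace class_ring V by (rule V)
  let ?g = "inv_into (carrier V) f"
  have g: "?g y \<in> carrier V" "f (?g y) = y" if "y \<in> carrier W" for y
    using bij that by (auto simp: bij_betw_def inv_into_into f_inv_into_f)
  have gf: "?g (f x) = x" if "x \<in> carrier V" for x
    using bij that by (simp add: bij_betw_def)
  show ?thesis
    unfolding class_module_hom_iff
  proof (intro conjI ballI allI)
    fix x y assume x: "x \<in> carrier W" and y: "y \<in> carrier W"
    have "f (?g x \<oplus>\<^bsub>V\<^esub> ?g y) = x \<oplus>\<^bsub>W\<^esub> y" using f g x y by (simp add: class_module_hom_iff)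
    then show "?g (x \<oplus>\<^bsub>W\<^esub> y) = ?g x \<oplus>\<^bsub>V\<^esub> ?g y"
      using gf[of "?g x \<oplus>\<^bsub>V\<^esub> ?g y"] g x y by simp
  next
    fix c x assume x: "x \<in> carrier W"
    have "f (c \<odot>\<^bsub>V\<^esub> ?g x) = c \<odot>\<^bsub>W\<^esub> x" using f g x by (simp add: class_module_hom_iff)
    moreover have "c \<odot>\<^bsub>V\<^esub> ?g x \<in> carrier V" using g[OF x] by simp
    ultimately show "?g (c \<odot>\<^bsub>W\<^esub> x) = c \<odot>\<^bsub>V\<^esub> ?g x" using gf by metis
  qed (use g in auto)
qed

text \<open>A subset of \<open>W\<close> is independent in \<open>W\<close> exactly when it is in
  \<open>V\<close>, so its size is bounded by the dimension of \<open>V\<close>; a maximal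
  independent subset therefore exists, and it generates \<open>W\<close>.\<close>

lemma (in vectorspace) subspace_fin_dim:
  assumes fd: fin_dim and W: "submodule K W V"
  shows "vectorspace.fin_dim K (vs W)"
proof -
  have sub: "subspace K W V" by (simp add: subspace_def W vectorspace_axioms)
  interpret W: vectorspace K "vs W" by (rule subspace_is_vs[OF sub])
  have WV: "W \<subseteq> carrier V" using W by (simp add: submodule_def)
  have li: "W.lin_dep S = lin_dep S" if "S \<subseteq> W" for S
    using span_li_not_depend(2)[OF that W] .
  have "\<exists>A. finite A \<and> maximal A (\<lambda>S. S \<subseteq> carrier (vs W) \<and> W.lin_indpt S)"
  proof (rule maximal_exists[where N = dim and B = "{}"])
    show "{} \<subseteq> carrier (vs W) \<and> W.lin_indpt {}" by (auto simp: W.lin_dep_def)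
    show "finite A \<and> card A \<le> dim" if "A \<subseteq> carrier (vs W) \<and> W.lin_indpt A" for A
      using li_le_dim[OF fd, of A] li[of A] that WV by auto
  qed
  then obtain A where "finite A" and A: "maximal A (\<lambda>S. S \<subseteq> carrier (vs W) \<and> W.lin_indpt S)"
    by blast
  moreover have "W.gen_set A" using W.max_li_is_gen[OF A] .
  ultimately show ?thesis unfolding W.fin_dim_def maximal_def by blast
qed

text \<open>Every axiom is pulled back through \<open>q\<close>. This serves the quotient, whose
  record is built from operations on sets and carries no axioms of its own.\<close>

lemma vectorspace_image:
  assumes V: "vectorspace K V"
    and carrier: "carrier W = q ` carrier V" and zero: "\<zero>\<^bsub>W\<^esub> = q \<zero>\<^bsub>V\<^esub>"
    and add: "\<And>x y. x \<in> carrier V \<Longrightarrow> y \<in> carrier V \<Longrightarrow> q x \<oplus>\<^bsub>W\<^esub> q y = q (x \<oplus>\<^bsub>V\<^esub> y)"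
    and smult: "\<And>c x. c \<in> carrier K \<Longrightarrow> x \<in> carrier V \<Longrightarrow> c \<odot>\<^bsub>W\<^esub> q x = q (c \<odot>\<^bsub>V\<^esub> x)"
  shows "vectorspace K W"
proof -
  interpret vectorspace K V by (rule V)
  show ?thesis
  proof (rule vs_criteria)
    show "\<forall>v\<in>carrier W. \<exists>neg_v\<in>carrier W. v \<oplus>\<^bsub>W\<^esub> neg_v = \<zero>\<^bsub>W\<^esub>"
    proof
      fix v assume "v \<in> carrier W"
      then obtain x where x: "x \<in> carrier V" "v = q x" by (auto simp: carrier)
      then have "v \<oplus>\<^bsub>W\<^esub> q (\<ominus>\<^bsub>V\<^esub> x) = \<zero>\<^bsub>W\<^esub>" by (simp add: add zero M.r_neg)
      then show "\<exists>neg_v\<in>carrier W. v \<oplus>\<^bsub>W\<^esub> neg_v = \<zero>\<^bsub>W\<^esub>" using x by (auto simp: carrier)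
    qed
    show "\<forall>v w x. v \<in> carrier W \<and> w \<in> carrier W \<and> x \<in> carrier W \<longrightarrow>
      v \<oplus>\<^bsub>W\<^esub> w \<oplus>\<^bsub>W\<^esub> x = v \<oplus>\<^bsub>W\<^esub> (w \<oplus>\<^bsub>W\<^esub> x)"
      by (auto simp: carrier add M.a_assoc)
    show "\<forall>v w. v \<in> carrier W \<and> w \<in> carrier W \<longrightarrow> v \<oplus>\<^bsub>W\<^esub> w = w \<oplus>\<^bsub>W\<^esub> v"
      by (auto simp: carrier add M.a_comm)
  qed (auto simp: carrier zero add smult smult_l_distr smult_r_distr smult_assoc1
      field_axioms intro!: imageI)
qed

section \<open>Quotients of vector spaces\<close>

lemma module_quot_facts:
  fixes V :: "('k::field, 'v) module"
  assumes V: "vectorspace class_ring V" and S: "submodule class_ring S V"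
  defines "q \<equiv> (\<lambda>x. S +>\<^bsub>V\<^esub> x)"
  shows module_quot_carrier: "carrier (module_quot V S) = q ` carrier V"
    and module_quot_zero: "\<zero>\<^bsub>module_quot V S\<^esub> = q \<zero>\<^bsub>V\<^esub>"
    and module_quot_add: "\<And>x y. x \<in> carrier V \<Longrightarrow> y \<in> carrier V \<Longrightarrow>
      q x \<oplus>\<^bsub>module_quot V S\<^esub> q y = q (x \<oplus>\<^bsub>V\<^esub> y)"
    and module_quot_smult: "\<And>c x. x \<in> carrier V \<Longrightarrow>
      c \<odot>\<^bsub>module_quot V S\<^esub> q x = q (c \<odot>\<^bsub>V\<^esub> x)"
    and module_quot_eqI: "\<And>x y. x \<in> S \<Longrightarrow> y \<in> carrier V \<Longrightarrow> q (x \<oplus>\<^bsub>V\<^esub> y) = q y"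
    and module_quot_repr: "\<And>x y. y \<in> carrier V \<Longrightarrow> x \<in> q y \<Longrightarrow> \<exists>s\<in>S. x = s \<oplus>\<^bsub>V\<^esub> y"
    and module_quot_self: "\<And>y. y \<in> carrier V \<Longrightarrow> y \<in> q y"
proof -
  interpret vectorspace class_ring V by (rule V)
  interpret S: submodule class_ring S V by (rule S)
  \<comment> \<open>Negatives are obtained as multiples by -1, which makes the submodule an additive
    subgroup and gives access to the coset library.\<close>
  have neg: "\<ominus>\<^bsub>V\<^esub> x \<in> S" if "x \<in> S" for x
  proof -
    have "(\<ominus>\<^bsub>class_ring\<^esub> \<one>\<^bsub>class_ring\<^esub>) \<odot>\<^bsub>V\<^esub> x \<in> S" using that by (intro S.smult_closed) auto
    then show ?thesis using subsetD[OF S.subset that] by (simp only: smult_minus_1)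
  qed
  have sg: "subgroup S (add_monoid V)"
  proof (rule M.add.subgroupI)
    show "S \<noteq> {}" using S.zero_closed by blast
  qed (use S.subset neg in \<open>auto simp: a_inv_def\<close>)
  interpret S: abelian_subgroup S V
    by (rule abelian_subgroupI3) (auto intro: additive_subgroupI sg M.abelian_group_axioms)
  show "carrier (module_quot V S) = q ` carrier V"
    by (auto simp: module_quot_def A_RCOSETS_def' q_def)
  show "\<zero>\<^bsub>module_quot V S\<^esub> = q \<zero>\<^bsub>V\<^esub>" by (simp add: module_quot_def q_def S.subset)
  show "q x \<oplus>\<^bsub>module_quot V S\<^esub> q y = q (x \<oplus>\<^bsub>V\<^esub> y)" if "x \<in> carrier V" "y \<in> carrier V" for x y
    using that by (simp add: module_quot_def q_def S.a_rcos_sum)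
  show eqI: "q (x \<oplus>\<^bsub>V\<^esub> y) = q y" if x: "x \<in> S" and y: "y \<in> carrier V" for x y
    using M.a_repr_independence[OF _ y sg, of "x \<oplus>\<^bsub>V\<^esub> y"] M.a_rcosI[OF x S.subset y]
    by (simp add: q_def)
  show repr: "\<exists>s\<in>S. x = s \<oplus>\<^bsub>V\<^esub> y" if "y \<in> carrier V" "x \<in> q y" for x y
    using that by (auto simp: q_def a_r_coset_def')
  show self: "y \<in> q y" if "y \<in> carrier V" for y
    using M.a_rcosI[OF S.zero_closed S.subset that] that by (simp add: q_def)
  show "c \<odot>\<^bsub>module_quot V S\<^esub> q x = q (c \<odot>\<^bsub>V\<^esub> x)" if x: "x \<in> carrier V" for c x
  proof -
    \<comment> \<open>Scalar multiplication on the quotient is a union over all representatives of a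
      coset. Each of them contributes the same coset, so the union collapses.\<close>
    have "q (c \<odot>\<^bsub>V\<^esub> y) = q (c \<odot>\<^bsub>V\<^esub> x)" if y: "y \<in> q x" for y
    proof -
      obtain s where s: "s \<in> S" "y = s \<oplus>\<^bsub>V\<^esub> x" using repr[OF x y] by blast
      then have "c \<odot>\<^bsub>V\<^esub> y = (c \<odot>\<^bsub>V\<^esub> s) \<oplus>\<^bsub>V\<^esub> (c \<odot>\<^bsub>V\<^esub> x)"
        using x subsetD[OF S.subset s(1)] by (simp add: smult_r_distr)
      moreover have "q ((c \<odot>\<^bsub>V\<^esub> s) \<oplus>\<^bsub>V\<^esub> (c \<odot>\<^bsub>V\<^esub> x)) = q (c \<odot>\<^bsub>V\<^esub> x)"
        using s(1) x by (intro eqI) auto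
      ultimately show ?thesis by (rule ssubst)
    qed
    then have "(\<Union>y\<in>q x. q (c \<odot>\<^bsub>V\<^esub> y)) = q (c \<odot>\<^bsub>V\<^esub> x)" using self[OF x] by blast
    then show ?thesis by (simp add: module_quot_def q_def)
  qed
qed

lemma
  fixes V :: "('k::field, 'v) module"
  assumes V: "vectorspace class_ring V" and S: "submodule class_ring S V"
  shows module_quot_vectorspace: "vectorspace class_ring (module_quot V S)"
    and module_quot_hom: "(\<lambda>x. S +>\<^bsub>V\<^esub> x) \<in> module_hom class_ring V (module_quot V S)"
    and module_quot_fin_dim:
      "vectorspace.fin_dim class_ring V \<Longrightarrow> vectorspace.fin_dim class_ring (module_quot V S)"
proof -
  note facts = module_quot_facts[OF V S]
  show vs: "vectorspace class_ring (module_quot V S)"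
    by (rule vectorspace_image[OF V facts(1-4)])
  show hom: "(\<lambda>x. S +>\<^bsub>V\<^esub> x) \<in> module_hom class_ring V (module_quot V S)"
    unfolding class_module_hom_iff using facts(1) by (simp add: facts(3,4) Pi_iff)
  interpret linear_map class_ring V "module_quot V S" "\<lambda>x. S +>\<^bsub>V\<^esub> x"
    by (rule linear_mapI[OF V vs hom])
  show "vectorspace.fin_dim class_ring (module_quot V S)" if "vectorspace.fin_dim class_ring V"
    using surj_fin_dim[OF that] facts(1) by simp
qed

text \<open>Rank-nullity: the image has dimension \<open>n\<close>, and the kernel accounts for the
  rest.\<close>

lemma dim_mono_surj:
  assumes V: "vectorspace class_ring V" "vectorspace.fin_dim class_ring V"
    and f: "f \<in> module_hom class_ring V (module_vec TYPE('k::field) n)"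
    and surj: "carrier_vec n \<subseteq> f ` carrier V"
  shows "n \<le> vectorspace.dim class_ring V"
proof -
  interpret W: vec_space "TYPE('k)" n .
  interpret linear_map class_ring V "module_vec TYPE('k) n" f
    by (rule linear_mapI[OF V(1) vec_vs f])
  have "imT = carrier_vec n"
    using surj f by (auto simp: im_def class_module_hom_iff module_vec_simps)
  then have "W.V\<lparr>carrier := imT\<rparr> = W.V" by (simp add: module_vec_def)
  then show ?thesis using rank_nullity[OF V(2)] W.dim_is_n by simp
qed


section \<open>Coordinates on a vector space\<close>

text \<open>
  \<open>V\<close> as a direct sum of spaces \<open>k\<^bsup>n j\<^esup>\<close>, with projections \<open>c j\<close> and inclusions \<open>e j\<close>; the
  induction principle takes the place of writing elements as finite sums.
\<close>

locale vdecomp =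
  fixes V :: "('k::field, 'v) module" and J :: "'j set" and n :: "'j \<Rightarrow> nat"
    and c :: "'j \<Rightarrow> 'v \<Rightarrow> 'k vec" and e :: "'j \<Rightarrow> 'k vec \<Rightarrow> 'v"
  assumes vs: "vectorspace class_ring V"
    and c_hom: "j \<in> J \<Longrightarrow> c j \<in> module_hom class_ring V (module_vec TYPE('k) (n j))"
    and e_hom: "j \<in> J \<Longrightarrow> e j \<in> module_hom class_ring (module_vec TYPE('k) (n j)) V"
    and c_e: "i \<in> J \<Longrightarrow> j \<in> J \<Longrightarrow> v \<in> carrier_vec (n j) \<Longrightarrow>
      c i (e j v) = (if i = j then v else 0\<^sub>v (n i))"
    and sep: "x \<in> carrier V \<Longrightarrow> y \<in> carrier V \<Longrightarrow> (\<And>j. j \<in> J \<Longrightarrow> c j x = c j y) \<Longrightarrow> x = y"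
    and induct [consumes 1, case_names zero add emb]:
      "x \<in> carrier V \<Longrightarrow> Q \<zero>\<^bsub>V\<^esub> \<Longrightarrow>
      (\<And>x y. x \<in> carrier V \<Longrightarrow> y \<in> carrier V \<Longrightarrow> Q x \<Longrightarrow> Q y \<Longrightarrow> Q (x \<oplus>\<^bsub>V\<^esub> y)) \<Longrightarrow>
      (\<And>j v. j \<in> J \<Longrightarrow> v \<in> carrier_vec (n j) \<Longrightarrow> Q (e j v)) \<Longrightarrow> Q x"
begin

sublocale vectorspace class_ring V by (rule vs)

lemma c_closed [simp, intro]: "j \<in> J \<Longrightarrow> x \<in> carrier V \<Longrightarrow> c j x \<in> carrier_vec (n j)"
  using c_hom[of j] by (auto simp: class_module_hom_iff module_vec_simps)

lemma e_closed [simp, intro]: "j \<in> J \<Longrightarrow> v \<in> carrier_vec (n j) \<Longrightarrow> e j v \<in> carrier V"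
  using e_hom[of j] by (auto simp: class_module_hom_iff module_vec_simps)

lemma c_add: "j \<in> J \<Longrightarrow> x \<in> carrier V \<Longrightarrow> y \<in> carrier V \<Longrightarrow> c j (x \<oplus>\<^bsub>V\<^esub> y) = c j x + c j y"
  using c_hom[of j] by (auto simp: class_module_hom_iff module_vec_simps)

lemma c_smult: "j \<in> J \<Longrightarrow> x \<in> carrier V \<Longrightarrow> c j (a \<odot>\<^bsub>V\<^esub> x) = a \<cdot>\<^sub>v c j x"
  using c_hom[of j] by (auto simp: class_module_hom_iff module_vec_simps)

lemma c_zero [simp]: assumes "j \<in> J" shows "c j \<zero>\<^bsub>V\<^esub> = 0\<^sub>v (n j)"
proof -
  interpret linear_map class_ring V "module_vec TYPE('k) (n j)" "c j"
    by (rule linear_mapI[OF vs vec_vs c_hom[OF assms]])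
  show ?thesis using f0_is_0 by (simp add: module_vec_simps)
qed

text \<open>The sum of the summands with index outside \<open>I\<close>. Describing it by equations
  rather than as a span lets it be compared directly with a reject, which is a common
  kernel.\<close>

definition vanishing :: "'j set \<Rightarrow> 'v set" where
  "vanishing I = {x \<in> carrier V. \<forall>j\<in>I. c j x = 0\<^sub>v (n j)}"

lemma submodule_vanishing: "I \<subseteq> J \<Longrightarrow> submodule class_ring (vanishing I) V"
  by unfold_locales (auto simp: vanishing_def c_add c_smult subset_iff)

text \<open>The maps \<open>c\<close> and \<open>e\<close> can be kept unchanged, because
  \<open>e j\<close> lands in \<open>vanishing I\<close> whenever \<open>j\<close> lies outside
  \<open>I\<close>.\<close>

lemma vdecomp_sub:
  assumes I: "I \<subseteq> J"
  shows "vdecomp (V\<lparr>carrier := vanishing I\<rparr>) (J - I) n c e"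
proof -
  let ?W = "V\<lparr>carrier := vanishing I\<rparr>"
  have sub: "subspace class_ring (vanishing I) V"
    using submodule_vanishing[OF I] by (simp add: subspace_def vs)
  have e_in: "e j v \<in> vanishing I" if "j \<in> J - I" "v \<in> carrier_vec (n j)" for j v
    using that I by (auto simp: vanishing_def c_e)
  show ?thesis
  proof (rule vdecomp.intro)
    show "c j \<in> module_hom class_ring ?W (module_vec TYPE('k) (n j))" if "j \<in> J - I" for j
      using c_hom[of j] that by (auto simp: class_module_hom_iff vanishing_def)
    show "e j \<in> module_hom class_ring (module_vec TYPE('k) (n j)) ?W" if "j \<in> J - I" for j
      using e_hom[of j] e_in[of j] that by (auto simp: class_module_hom_iff module_vec_simps)
    show "x = y" if "x \<in> carrier ?W" "y \<in> carrier ?W" "\<And>j. j \<in> J - I \<Longrightarrow> c j x = c j y" for x y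
    proof (rule sep)
      show "c j x = c j y" if "j \<in> J" for j
        using that \<open>x \<in> carrier ?W\<close> \<open>y \<in> carrier ?W\<close> \<open>\<And>j. j \<in> J - I \<Longrightarrow> c j x = c j y\<close>[of j]
        by (cases "j \<in> I") (auto simp: vanishing_def)
    qed (use that in \<open>auto simp: vanishing_def\<close>)
    show "Q x" if x: "x \<in> carrier ?W" and zero: "Q \<zero>\<^bsub>?W\<^esub>"
      and add: "\<And>x y. x \<in> carrier ?W \<Longrightarrow> y \<in> carrier ?W \<Longrightarrow> Q x \<Longrightarrow> Q y \<Longrightarrow> Q (x \<oplus>\<^bsub>?W\<^esub> y)"
      and emb: "\<And>j v. j \<in> J - I \<Longrightarrow> v \<in> carrier_vec (n j) \<Longrightarrow> Q (e j v)" for Q x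
    proof -
      \<comment> \<open>The intermediate summands need not vanish on \<open>I\<close>, so the induction runs over the projection.\<close>
      let ?Q = "\<lambda>x. \<exists>y\<in>vanishing I. Q y \<and> (\<forall>j\<in>J - I. c j y = c j x)"
      from x have xV: "x \<in> carrier V" by (simp add: vanishing_def)
      then have "?Q x"
      proof (induct rule: induct)
        case zero
        then show ?case
          using \<open>Q \<zero>\<^bsub>?W\<^esub>\<close> I by (intro bexI[of _ "\<zero>\<^bsub>V\<^esub>"]) (auto simp: vanishing_def)
      next
        case (add x1 x2)
        then obtain y1 y2 where y: "y1 \<in> vanishing I" "Q y1" "\<forall>j\<in>J - I. c j y1 = c j x1"
          "y2 \<in> vanishing I" "Q y2" "\<forall>j\<in>J - I. c j y2 = c j x2" by blast
        have "y1 \<oplus>\<^bsub>V\<^esub> y2 \<in> vanishing I"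
          using y submodule_vanishing[OF I] by (simp add: submodule.m_closed)
        moreover have "Q (y1 \<oplus>\<^bsub>V\<^esub> y2)" using that(3)[of y1 y2] y by simp
        ultimately show ?case
          using y add by (intro bexI[of _ "y1 \<oplus>\<^bsub>V\<^esub> y2"]) (auto simp: c_add vanishing_def)
      next
        case (emb j v)
        show ?case
        proof (cases "j \<in> I")
          case True
          then show ?thesis
            using emb I zero by (intro bexI[of _ "\<zero>\<^bsub>V\<^esub>"]) (auto simp: vanishing_def c_e)
        next
          case False
          then show ?thesis using emb that(4)[of j v] e_in[of j v] by blast
        qed
      qed
      then obtain y where y: "y \<in> vanishing I" "Q y" "\<forall>j\<in>J - I. c j y = c j x" by blast
      have "y = x"
      proof (rule sep)
        show "c j y = c j x" if "j \<in> J" for j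
          using that y x by (cases "j \<in> I") (auto simp: vanishing_def)
      qed (use x y in \<open>auto simp: vanishing_def\<close>)
      then show ?thesis using y by simp
    qed
  qed (use subspace_is_vs[OF sub] in \<open>simp_all add: c_e\<close>)
qed

lemma vanishing_induct [consumes 2, case_names zero add emb]:
  assumes "I \<subseteq> J" "x \<in> vanishing I" "Q \<zero>\<^bsub>V\<^esub>"
    "\<And>x y. x \<in> vanishing I \<Longrightarrow> y \<in> vanishing I \<Longrightarrow> Q x \<Longrightarrow> Q y \<Longrightarrow> Q (x \<oplus>\<^bsub>V\<^esub> y)"
    "\<And>j v. j \<in> J - I \<Longrightarrow> v \<in> carrier_vec (n j) \<Longrightarrow> Q (e j v)"
  shows "Q x"
  using vdecomp.induct[OF vdecomp_sub[OF assms(1)], of x Q] assms by simp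

text \<open>\<open>vanishing I\<close> is generated by the embedded summands outside
  \<open>I\<close>, so a homomorphism has to be tested on these only.\<close>

lemma hom_vanishes:
  assumes "I \<subseteq> J" "x \<in> vanishing I" and W: "vectorspace class_ring W"
    and f: "f \<in> module_hom class_ring V W"
    and emb: "\<And>j v. j \<in> J - I \<Longrightarrow> v \<in> carrier_vec (n j) \<Longrightarrow> f (e j v) = \<zero>\<^bsub>W\<^esub>"
  shows "f x = \<zero>\<^bsub>W\<^esub>"
proof -
  interpret f: linear_map class_ring V W f by (rule linear_mapI[OF vs W f])
  show ?thesis
    using assms(1,2)
    by (induct rule: vanishing_induct) (auto simp: emb vanishing_def)
qed

abbreviation (input) coset :: "'j set \<Rightarrow> 'v \<Rightarrow> 'v set" where
  "coset I x \<equiv> vanishing I +>\<^bsub>V\<^esub> x"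

text \<open>Elements of \<open>vanishing I\<close> have coordinate 0 at each index in
  \<open>I\<close>, so \<open>c j\<close> is constant on a coset and its image there is a singleton.
  This is how \<open>c j\<close> descends to the quotient.\<close>

lemma the_elem_coset:
  assumes I: "I \<subseteq> J" and j: "j \<in> I" and x: "x \<in> carrier V"
  shows "the_elem (c j ` coset I x) = c j x"
proof -
  note quot = module_quot_facts[OF vs submodule_vanishing[OF I]]
  have "c j y = c j x" if y: "y \<in> coset I x" for y
  proof -
    obtain s where s: "s \<in> vanishing I" "y = s \<oplus>\<^bsub>V\<^esub> x" using quot(6)[OF x y] by blast
    moreover have "j \<in> J" using j I by blast
    ultimately show ?thesis using j x by (simp add: vanishing_def c_add)
  qed
  then have "c j ` coset I x = {c j x}" using quot(7)[OF x] by blast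
  then show ?thesis by simp
qed

text \<open>Complementary to \<open>vdecomp_sub\<close>: the subspace keeps the indices in
  \<open>J - I\<close>, the quotient by it keeps those in \<open>I\<close>.\<close>

lemma vdecomp_quot:
  assumes I: "I \<subseteq> J"
  shows "vdecomp (module_quot V (vanishing I)) I n (\<lambda>j C. the_elem (c j ` C)) (\<lambda>j v. coset I (e j v))"
proof -
  let ?W = "module_quot V (vanishing I)"
  note sm = submodule_vanishing[OF I]
  note quot = module_quot_facts[OF vs sm]
  note c_image = the_elem_coset[OF I]
  show ?thesis
  proof (rule vdecomp.intro)
    show "(\<lambda>C. the_elem (c j ` C)) \<in> module_hom class_ring ?W (module_vec TYPE('k) (n j))"
      if "j \<in> I" for j
      unfolding class_module_hom_iff
      using that I quot by (auto simp: c_image c_add c_smult module_vec_simps subset_iff)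
    show "(\<lambda>v. coset I (e j v)) \<in> module_hom class_ring (module_vec TYPE('k) (n j)) ?W"
      if "j \<in> I" for j
      by (rule module_hom_comp[OF e_hom module_quot_hom[OF vs sm]]) (use that I in auto)
    show "the_elem (c i ` coset I (e j v)) = (if i = j then v else 0\<^sub>v (n i))"
      if "i \<in> I" "j \<in> I" "v \<in> carrier_vec (n j)" for i j v
      using that I c_image[of i "e j v"] by (auto simp: c_e subset_iff)
    show "x = y" if x: "x \<in> carrier ?W" and y: "y \<in> carrier ?W"
      and c: "\<And>j. j \<in> I \<Longrightarrow> the_elem (c j ` x) = the_elem (c j ` y)" for x y
    proof -
      obtain x' y' where x': "x = coset I x'" "x' \<in> carrier V" and y': "y = coset I y'" "y' \<in> carrier V"
        using x y quot(1) by auto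
      \<comment> \<open>Write x' as (x' - y') + y' and cancel the coordinate of y' entry by entry;
        the difference then lies in \<open>vanishing I\<close>, and x' and y' have the same
        coset.\<close>
      have "c j (x' \<ominus>\<^bsub>V\<^esub> y') = 0\<^sub>v (n j)" if j: "j \<in> I" for j
      proof -
        have jJ: "j \<in> J" using j I by blast
        have "c j (x' \<ominus>\<^bsub>V\<^esub> y') + c j y' = c j ((x' \<ominus>\<^bsub>V\<^esub> y') \<oplus>\<^bsub>V\<^esub> y')"
          using jJ x' y' by (simp add: c_add)
        also have "(x' \<ominus>\<^bsub>V\<^esub> y') \<oplus>\<^bsub>V\<^esub> y' = x'"
          using x' y' by (simp add: M.minus_eq M.a_assoc M.l_neg)
        also have "c j x' = c j y'" using c[OF j] j x' y' by (simp add: c_image)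
        finally have eq: "c j (x' \<ominus>\<^bsub>V\<^esub> y') + c j y' = c j y'" .
        have "c j (x' \<ominus>\<^bsub>V\<^esub> y') \<in> carrier_vec (n j)" "c j y' \<in> carrier_vec (n j)"
          using jJ x' y' by auto
        then show ?thesis
        proof (intro eq_vecI)
          fix i assume i: "i < dim_vec (0\<^sub>v (n j) :: 'k vec)"
          then show "c j (x' \<ominus>\<^bsub>V\<^esub> y') $ i = 0\<^sub>v (n j) $ i"
            using arg_cong[OF eq, of "\<lambda>v. v $ i"] \<open>c j y' \<in> carrier_vec (n j)\<close> by simp
        qed simp
      qed
      then have "x' \<ominus>\<^bsub>V\<^esub> y' \<in> vanishing I" using x' y' by (simp add: vanishing_def)
      then have "coset I ((x' \<ominus>\<^bsub>V\<^esub> y') \<oplus>\<^bsub>V\<^esub> y') = coset I y'" using y' by (intro quot(5))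
      moreover have "(x' \<ominus>\<^bsub>V\<^esub> y') \<oplus>\<^bsub>V\<^esub> y' = x'"
        using x' y' by (simp add: M.minus_eq M.a_assoc M.l_neg)
      ultimately show ?thesis using x' y' by simp
    qed
    show "Q x" if x: "x \<in> carrier ?W" and zero: "Q \<zero>\<^bsub>?W\<^esub>"
      and add: "\<And>x y. x \<in> carrier ?W \<Longrightarrow> y \<in> carrier ?W \<Longrightarrow> Q x \<Longrightarrow> Q y \<Longrightarrow> Q (x \<oplus>\<^bsub>?W\<^esub> y)"
      and emb: "\<And>j v. j \<in> I \<Longrightarrow> v \<in> carrier_vec (n j) \<Longrightarrow> Q (coset I (e j v))" for Q x
    proof -
      obtain x' where x': "x = coset I x'" "x' \<in> carrier V" using x quot(1) by auto
      from x'(2) have "Q (coset I x')"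
      proof (induct rule: induct)
        case zero
        then show ?case using that(2) quot(2) by simp
      next
        case (add y z)
        then show ?case using that(3)[of "coset I y" "coset I z"] quot(1,3) by auto
      next
        case (emb j v)
        show ?case
        proof (cases "j \<in> I")
          case True
          then show ?thesis using emb that(4) by blast
        next
          case False
          then have "e j v \<in> vanishing I" using emb I by (auto simp: vanishing_def c_e subset_iff)
          then have "coset I (e j v) = coset I \<zero>\<^bsub>V\<^esub>" using quot(5)[of "e j v" "\<zero>\<^bsub>V\<^esub>"] emb by simp
          then show ?thesis using that(2) quot(2) by simp
        qed
      qed
      then show ?thesis using x' by simp
    qed
  qed (rule module_quot_vectorspace[OF vs sm])
qed

text \<open>\<open>e j\<close> is a section of \<open>c j\<close>, so \<open>c j\<close> is onto.
  All bounds on indices in S_M come from here.\<close>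

lemma dim_le:
  assumes j: "j \<in> J" and "fin_dim"
  shows "n j \<le> dim"
proof (rule dim_mono_surj[OF vs _ c_hom[OF j]])
  show "carrier_vec (n j) \<subseteq> c j ` carrier V"
  proof
    fix v :: "'k vec" assume "v \<in> carrier_vec (n j)"
    then have "c j (e j v) = v" "e j v \<in> carrier V" using j by (simp_all add: c_e)
    then show "v \<in> c j ` carrier V" by force
  qed
qed (rule assms)

end


section \<open>Rejects and traces\<close>

lemma fin_dim_krep_iff:
  "fin_dim_krep M \<longleftrightarrow> vectorspace class_ring (V1 M) \<and> vectorspace class_ring (V2 M) \<and>
    arr_a M \<in> module_hom class_ring (V1 M) (V2 M) \<and> arr_b M \<in> module_hom class_ring (V1 M) (V2 M) \<and>
    vectorspace.fin_dim class_ring (V1 M) \<and> vectorspace.fin_dim class_ring (V2 M)"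
  unfolding fin_dim_krep_def by (auto intro: linear_mapI dest: linear_mapD)

lemma krep_hom_iff:
  "(f, g) \<in> krep_hom M N \<longleftrightarrow>
     f \<in> module_hom class_ring (V1 M) (V1 N) \<and> g \<in> module_hom class_ring (V2 M) (V2 N) \<and>
     (\<forall>x \<in> carrier (V1 M). g (arr_a M x) = arr_a N (f x) \<and> g (arr_b M x) = arr_b N (f x))"
  by (simp add: krep_hom_def)

lemma krep_hom_closed:
  assumes "(f, g) \<in> krep_hom M N"
  shows "x \<in> carrier (V1 M) \<Longrightarrow> f x \<in> carrier (V1 N)" "y \<in> carrier (V2 M) \<Longrightarrow> g y \<in> carrier (V2 N)"
  using assms by (auto simp: krep_hom_iff class_module_hom_iff)

lemma krep_hom_comp:
  assumes "(f, g) \<in> krep_hom M N" "(f', g') \<in> krep_hom N P"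
  shows "((\<lambda>x. f' (f x)), (\<lambda>y. g' (g y))) \<in> krep_hom M P"
  using assms unfolding krep_hom_iff
  by (auto intro: module_hom_comp) (auto simp: class_module_hom_iff)

lemma krep_sub_simps [simp]:
  "V1 (krep_sub M S T) = (V1 M)\<lparr>carrier := S\<rparr>" "V2 (krep_sub M S T) = (V2 M)\<lparr>carrier := T\<rparr>"
  "arr_a (krep_sub M S T) = arr_a M" "arr_b (krep_sub M S T) = arr_b M"
  by (simp_all add: krep_sub_def)

lemma fin_dim_krep_sub:
  assumes M: "fin_dim_krep M"
    and S: "submodule class_ring S (V1 M)" and T: "submodule class_ring T (V2 M)"
    and arr: "\<And>x. x \<in> S \<Longrightarrow> arr_a M x \<in> T" "\<And>x. x \<in> S \<Longrightarrow> arr_b M x \<in> T"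
  shows "fin_dim_krep (krep_sub M S T)"
proof -
  interpret V1: vectorspace class_ring "V1 M" using M by (simp add: fin_dim_krep_iff)
  interpret V2: vectorspace class_ring "V2 M" using M by (simp add: fin_dim_krep_iff)
  have sub: "subspace class_ring S (V1 M)" "subspace class_ring T (V2 M)"
    using S T by (simp_all add: subspace_def V1.vectorspace_axioms V2.vectorspace_axioms)
  have "S \<subseteq> carrier (V1 M)" using S by (simp add: submodule_def)
  then show ?thesis
    using M arr V1.subspace_is_vs[OF sub(1)] V2.subspace_is_vs[OF sub(2)]
      V1.subspace_fin_dim[OF _ S] V2.subspace_fin_dim[OF _ T]
    unfolding fin_dim_krep_iff by (auto simp: class_module_hom_iff subset_iff)
qed

lemma krep_quot_simps:
  "V1 (krep_quot M (krep_sub N S T)) = module_quot (V1 M) S"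
  "V2 (krep_quot M (krep_sub N S T)) = module_quot (V2 M) T"
  by (simp_all add: krep_quot_def)

text \<open>The arrows of the quotient are unions over representatives. Since the arrows of
  \<open>M\<close> send \<open>S\<close> into \<open>T\<close>, all representatives give the same
  coset.\<close>

lemma krep_quot_arr:
  assumes M: "fin_dim_krep M"
    and S: "submodule class_ring S (V1 M)" and T: "submodule class_ring T (V2 M)"
    and arr: "\<And>x. x \<in> S \<Longrightarrow> arr_a M x \<in> T" "\<And>x. x \<in> S \<Longrightarrow> arr_b M x \<in> T"
    and x: "x \<in> carrier (V1 M)"
  shows "arr_a (krep_quot M (krep_sub N S T)) (S +>\<^bsub>V1 M\<^esub> x) = T +>\<^bsub>V2 M\<^esub> arr_a M x"
    and "arr_b (krep_quot M (krep_sub N S T)) (S +>\<^bsub>V1 M\<^esub> x) = T +>\<^bsub>V2 M\<^esub> arr_b M x"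
proof -
  have vs: "vectorspace class_ring (V1 M)" "vectorspace class_ring (V2 M)"
    using M by (simp_all add: fin_dim_krep_iff)
  note q1 = module_quot_facts[OF vs(1) S] and q2 = module_quot_facts[OF vs(2) T]
  have "(\<Union>y\<in>S +>\<^bsub>V1 M\<^esub> x. T +>\<^bsub>V2 M\<^esub> h y) = T +>\<^bsub>V2 M\<^esub> h x"
    if h: "h \<in> module_hom class_ring (V1 M) (V2 M)" "\<And>x. x \<in> S \<Longrightarrow> h x \<in> T" for h
  proof -
    have "T +>\<^bsub>V2 M\<^esub> h y = T +>\<^bsub>V2 M\<^esub> h x" if y: "y \<in> S +>\<^bsub>V1 M\<^esub> x" for y
    proof -
      obtain s where s: "s \<in> S" "y = s \<oplus>\<^bsub>V1 M\<^esub> x" using q1(6)[OF x y] by blast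
      have "s \<in> carrier (V1 M)" using s S by (auto simp: submodule_def)
      then have "h y = h s \<oplus>\<^bsub>V2 M\<^esub> h x" "h x \<in> carrier (V2 M)"
        using s(2) x h(1) by (auto simp: class_module_hom_iff)
      then show ?thesis using q2(5)[OF h(2)[OF s(1)], of "h x"] by simp
    qed
    then show ?thesis using q1(7)[OF x] by blast
  qed
  then show "arr_a (krep_quot M (krep_sub N S T)) (S +>\<^bsub>V1 M\<^esub> x) = T +>\<^bsub>V2 M\<^esub> arr_a M x"
    "arr_b (krep_quot M (krep_sub N S T)) (S +>\<^bsub>V1 M\<^esub> x) = T +>\<^bsub>V2 M\<^esub> arr_b M x"
    using M arr by (simp_all add: krep_quot_def fin_dim_krep_iff)
qed

lemma fin_dim_krep_quot:
  assumes M: "fin_dim_krep M"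
    and S: "submodule class_ring S (V1 M)" and T: "submodule class_ring T (V2 M)"
    and arr: "\<And>x. x \<in> S \<Longrightarrow> arr_a M x \<in> T" "\<And>x. x \<in> S \<Longrightarrow> arr_b M x \<in> T"
  shows "fin_dim_krep (krep_quot M (krep_sub N S T))"
proof -
  let ?Q = "krep_quot M (krep_sub N S T)"
  have vs: "vectorspace class_ring (V1 M)" "vectorspace class_ring (V2 M)"
    using M by (simp_all add: fin_dim_krep_iff)
  note q1 = module_quot_facts[OF vs(1) S] and q2 = module_quot_facts[OF vs(2) T]
  have "h \<in> module_hom class_ring (V1 ?Q) (V2 ?Q)"
    if k: "k \<in> module_hom class_ring (V1 M) (V2 M)"
      and h: "\<And>x. x \<in> carrier (V1 M) \<Longrightarrow> h (S +>\<^bsub>V1 M\<^esub> x) = T +>\<^bsub>V2 M\<^esub> k x" for h k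
  proof -
    interpret V1: vectorspace class_ring "V1 M" by (rule vs)
    have k': "k x \<in> carrier (V2 M)" "k (x \<oplus>\<^bsub>V1 M\<^esub> y) = k x \<oplus>\<^bsub>V2 M\<^esub> k y"
      "k (c \<odot>\<^bsub>V1 M\<^esub> x) = c \<odot>\<^bsub>V2 M\<^esub> k x"
      if "x \<in> carrier (V1 M)" "y \<in> carrier (V1 M)" for x y c
      using k that by (auto simp: class_module_hom_iff)
    show ?thesis
      unfolding class_module_hom_iff krep_quot_simps q1(1) q2(1)
      by (auto simp: h k' q1(3,4) q2(3,4))
  qed
  then show "fin_dim_krep ?Q"
    using M krep_quot_arr[OF M S T arr, where N = N]
    unfolding fin_dim_krep_iff krep_quot_simps
    by (auto intro!: module_quot_vectorspace module_quot_fin_dim S T)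
qed

lemma hom_zero:
  assumes "vectorspace class_ring V" "vectorspace class_ring W" "f \<in> module_hom class_ring V W"
  shows "f \<zero>\<^bsub>V\<^esub> = \<zero>\<^bsub>W\<^esub>"
proof -
  interpret linear_map class_ring V W f by (rule linear_mapI) fact+
  show ?thesis by simp
qed

text \<open>Applied with \<open>I\<close> the set of homomorphism pairs and \<open>h\<close> one of
  the two projections of a pair, so that it covers both vertices of a reject.\<close>

lemma submodule_common_kernel:
  assumes V: "vectorspace class_ring V" and W: "vectorspace class_ring W"
    and h: "\<And>i. i \<in> I \<Longrightarrow> h i \<in> module_hom class_ring V W"
  shows "submodule class_ring {x \<in> carrier V. \<forall>i\<in>I. h i x = \<zero>\<^bsub>W\<^esub>} V"
proof -
  interpret V: vectorspace class_ring V by (rule V)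
  interpret W: vectorspace class_ring W by (rule W)
  have h_hom: "h i (x \<oplus>\<^bsub>V\<^esub> y) = h i x \<oplus>\<^bsub>W\<^esub> h i y" "h i (a \<odot>\<^bsub>V\<^esub> x) = a \<odot>\<^bsub>W\<^esub> h i x"
    if "i \<in> I" "x \<in> carrier V" "y \<in> carrier V" for i x y a
    using h[OF that(1)] that by (auto simp: class_module_hom_iff)
  show ?thesis
    using hom_zero[OF V W h] by unfold_locales (auto simp: h_hom)
qed

section \<open>Rejects and traces as finite-dimensional representations\<close>

lemma fin_dim_krep_reject:
  assumes N: "fin_dim_krep N" and U: "fin_dim_krep U"
  shows "fin_dim_krep (krep_reject N U)"
  unfolding krep_reject_def
proof (rule fin_dim_krep_sub[OF N])
  have vs: "vectorspace class_ring (V1 N)" "vectorspace class_ring (V2 N)"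
    "vectorspace class_ring (V1 U)" "vectorspace class_ring (V2 U)"
    using N U by (simp_all add: fin_dim_krep_iff)
  show "submodule class_ring {x \<in> carrier (V1 N). \<forall>(f, g)\<in>krep_hom N U. f x = \<zero>\<^bsub>V1 U\<^esub>} (V1 N)"
    using submodule_common_kernel[OF vs(1,3), of "krep_hom N U" fst] by (auto simp: case_prod_unfold krep_hom_def)
  show "submodule class_ring {x \<in> carrier (V2 N). \<forall>(f, g)\<in>krep_hom N U. g x = \<zero>\<^bsub>V2 U\<^esub>} (V2 N)"
    using submodule_common_kernel[OF vs(2,4), of "krep_hom N U" snd] by (auto simp: case_prod_unfold krep_hom_def)
  have "arr_a U \<zero>\<^bsub>V1 U\<^esub> = \<zero>\<^bsub>V2 U\<^esub>" "arr_b U \<zero>\<^bsub>V1 U\<^esub> = \<zero>\<^bsub>V2 U\<^esub>"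
    using U by (auto simp: fin_dim_krep_iff intro: hom_zero)
  then show "arr_a N x \<in> {y \<in> carrier (V2 N). \<forall>(f, g)\<in>krep_hom N U. g y = \<zero>\<^bsub>V2 U\<^esub>}"
    "arr_b N x \<in> {y \<in> carrier (V2 N). \<forall>(f, g)\<in>krep_hom N U. g y = \<zero>\<^bsub>V2 U\<^esub>}"
    if "x \<in> {x \<in> carrier (V1 N). \<forall>(f, g)\<in>krep_hom N U. f x = \<zero>\<^bsub>V1 U\<^esub>}" for x
    using that N by (auto simp: krep_hom_iff fin_dim_krep_iff class_module_hom_iff)
qed

text \<open>The preimage of the span of \<open>B\<close> is a submodule containing \<open>A\<close>,
  hence contains the span of \<open>A\<close>.\<close>

lemma hom_span:
  assumes V: "vectorspace class_ring V" and W: "vectorspace class_ring W"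
    and h: "h \<in> module_hom class_ring V W" and A: "A \<subseteq> carrier V" and B: "B \<subseteq> carrier W"
    and AB: "h ` A \<subseteq> B" and x: "x \<in> module.span class_ring V A"
  shows "h x \<in> module.span class_ring W B"
proof -
  interpret V: vectorspace class_ring V by (rule V)
  interpret W: vectorspace class_ring W by (rule W)
  interpret B: submodule class_ring "W.span B" W by (rule W.span_is_submodule[OF B])
  have "submodule class_ring {x \<in> carrier V. h x \<in> W.span B} V"
  proof
    show "\<zero>\<^bsub>V\<^esub> \<in> {x \<in> carrier V. h x \<in> W.span B}"
      using hom_zero[OF V W h] by simp
  qed (use h in \<open>auto simp: class_module_hom_iff\<close>)
  moreover have "A \<subseteq> {x \<in> carrier V. h x \<in> W.span B}"
    using A AB W.in_own_span[OF B] by auto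
  ultimately show ?thesis using V.span_is_subset x by blast
qed

text \<open>Closure under the arrows is visible on generators: a homomorphism \<open>(f, g)\<close>
  satisfies \<open>arr_a N (f y) = g (arr_a U y)\<close>, and likewise for \<open>arr_b\<close>.
  \<open>hom_span\<close> extends this to spans.\<close>

lemma trace_submodule:
  assumes N: "fin_dim_krep N" and U: "fin_dim_krep U"
  defines "S \<equiv> module.span class_ring (V1 N) (\<Union>(f, g) \<in> krep_hom U N. f ` carrier (V1 U))"
    and "T \<equiv> module.span class_ring (V2 N) (\<Union>(f, g) \<in> krep_hom U N. g ` carrier (V2 U))"
  shows "submodule class_ring S (V1 N)" "submodule class_ring T (V2 N)"
    and "x \<in> S \<Longrightarrow> arr_a N x \<in> T" "x \<in> S \<Longrightarrow> arr_b N x \<in> T"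
proof -
  have vs: "vectorspace class_ring (V1 N)" "vectorspace class_ring (V2 N)"
    using N by (simp_all add: fin_dim_krep_iff)
  interpret V1: vectorspace class_ring "V1 N" by (rule vs)
  interpret V2: vectorspace class_ring "V2 N" by (rule vs)
  have sub: "(\<Union>(f, g) \<in> krep_hom U N. f ` carrier (V1 U)) \<subseteq> carrier (V1 N)"
    "(\<Union>(f, g) \<in> krep_hom U N. g ` carrier (V2 U)) \<subseteq> carrier (V2 N)"
    using krep_hom_closed by fast+
  show "submodule class_ring S (V1 N)" "submodule class_ring T (V2 N)"
    unfolding S_def T_def
    by (rule V1.span_is_submodule[OF sub(1)], rule V2.span_is_submodule[OF sub(2)])
  have U_arr: "arr_a U y \<in> carrier (V2 U)" "arr_b U y \<in> carrier (V2 U)" if "y \<in> carrier (V1 U)" for y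
    using U that by (auto simp: fin_dim_krep_iff class_module_hom_iff)
  have "arr_a N ` (\<Union>(f, g) \<in> krep_hom U N. f ` carrier (V1 U)) \<subseteq> (\<Union>(f, g) \<in> krep_hom U N. g ` carrier (V2 U))"
  proof clarsimp
    fix f g y assume "(f, g) \<in> krep_hom U N" "y \<in> carrier (V1 U)"
    then show "\<exists>x\<in>krep_hom U N. arr_a N (f y) \<in> (case x of (f, g) \<Rightarrow> g ` carrier (V2 U))"
      using U_arr[of y]
      by (intro bexI[of _ "(f, g)"]) (auto simp: krep_hom_iff intro!: image_eqI[of _ g "arr_a U y"])
  qed
  then show "x \<in> S \<Longrightarrow> arr_a N x \<in> T"
    unfolding S_def T_def using hom_span[OF vs _ sub] N unfolding fin_dim_krep_iff by blast
  have "arr_b N ` (\<Union>(f, g) \<in> krep_hom U N. f ` carrier (V1 U)) \<subseteq> (\<Union>(f, g) \<in> krep_hom U N. g ` carrier (V2 U))"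
  proof clarsimp
    fix f g y assume "(f, g) \<in> krep_hom U N" "y \<in> carrier (V1 U)"
    then show "\<exists>x\<in>krep_hom U N. arr_b N (f y) \<in> (case x of (f, g) \<Rightarrow> g ` carrier (V2 U))"
      using U_arr[of y]
      by (intro bexI[of _ "(f, g)"]) (auto simp: krep_hom_iff intro!: image_eqI[of _ g "arr_b U y"])
  qed
  then show "x \<in> S \<Longrightarrow> arr_b N x \<in> T"
    unfolding S_def T_def using hom_span[OF vs _ sub] N unfolding fin_dim_krep_iff by blast
qed

lemma fin_dim_krep_quot_trace:
  assumes N: "fin_dim_krep N" and U: "fin_dim_krep U"
  shows "fin_dim_krep (krep_quot N (krep_trace N U))"
  unfolding krep_trace_def by (rule fin_dim_krep_quot[OF N trace_submodule[OF N U]])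

lemma mat_krep_simps:
  "V1 (mat_krep X) = module_vec TYPE('k::field) (dim_col (fst X))"
  "V2 (mat_krep X) = module_vec TYPE('k) (dim_row (fst X))"
  "arr_a (mat_krep X) = (\<lambda>v. fst X *\<^sub>v v)" "arr_b (mat_krep X) = (\<lambda>v. snd X *\<^sub>v v)"
  by (auto simp: mat_krep_def case_prod_unfold)

lemma fin_dim_mat_krep:
  assumes "snd X \<in> carrier_mat (dim_row (fst X)) (dim_col (fst X))"
  shows "fin_dim_krep (mat_krep X)"
proof -
  have "(\<lambda>v. A *\<^sub>v v) \<in> module_hom class_ring (module_vec TYPE('a) m) (module_vec TYPE('a) n)"
    if "A \<in> carrier_mat n m" for A :: "'a mat" and n m
    using that unfolding class_module_hom_iff
    by (auto simp: module_vec_simps mult_add_distrib_mat_vec mult_mat_vec)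
  then show ?thesis
    using assms unfolding fin_dim_krep_iff mat_krep_simps
    by (auto intro: vec_vs vec_space.fin_dim)
qed


section \<open>Decomposed representations\<close>

text \<open>The two vertex spaces are decomposed separately but share the index set and the labels
  \<open>L\<close>. Compatibility with the arrows is required of the projections;
  \<open>e_krep\<close> derives it for the inclusions.\<close>

locale kdecomp =
  fixes M :: "('k::field, 'v, 'w) krep" and J :: "'j set" and L :: "'j \<Rightarrow> 'k mat \<times> 'k mat"
    and c1 :: "'j \<Rightarrow> 'v \<Rightarrow> 'k vec" and e1 :: "'j \<Rightarrow> 'k vec \<Rightarrow> 'v"
    and c2 :: "'j \<Rightarrow> 'w \<Rightarrow> 'k vec" and e2 :: "'j \<Rightarrow> 'k vec \<Rightarrow> 'w"
  assumes krep: "fin_dim_krep M"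
    and vd1: "vdecomp (V1 M) J (\<lambda>j. dim_col (fst (L j))) c1 e1"
    and vd2: "vdecomp (V2 M) J (\<lambda>j. dim_row (fst (L j))) c2 e2"
    and krep_L: "j \<in> J \<Longrightarrow> fin_dim_krep (mat_krep (L j))"
    and c_krep: "j \<in> J \<Longrightarrow> (c1 j, c2 j) \<in> krep_hom M (mat_krep (L j))"
begin

sublocale v1: vdecomp "V1 M" J "\<lambda>j. dim_col (fst (L j))" c1 e1 by (rule vd1)
sublocale v2: vdecomp "V2 M" J "\<lambda>j. dim_row (fst (L j))" c2 e2 by (rule vd2)

lemma krep_M: "arr_a M \<in> module_hom class_ring (V1 M) (V2 M)"
    "arr_b M \<in> module_hom class_ring (V1 M) (V2 M)"
    "v1.fin_dim" "v2.fin_dim"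
  using krep by (simp_all add: fin_dim_krep_iff)

lemma arr_closed:
  "x \<in> carrier (V1 M) \<Longrightarrow> arr_a M x \<in> carrier (V2 M)" "x \<in> carrier (V1 M) \<Longrightarrow> arr_b M x \<in> carrier (V2 M)"
  using krep_M by (auto simp: class_module_hom_iff)

lemma c_arr:
  assumes "j \<in> J" "x \<in> carrier (V1 M)"
  shows "c2 j (arr_a M x) = fst (L j) *\<^sub>v c1 j x" "c2 j (arr_b M x) = snd (L j) *\<^sub>v c1 j x"
  using c_krep[OF assms(1)] assms(2) by (auto simp: krep_hom_iff mat_krep_simps)

lemma L_zero:
  assumes "j \<in> J"
  shows "fst (L j) *\<^sub>v 0\<^sub>v (dim_col (fst (L j))) = 0\<^sub>v (dim_row (fst (L j)))"
    "snd (L j) *\<^sub>v 0\<^sub>v (dim_col (fst (L j))) = 0\<^sub>v (dim_row (fst (L j)))"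
  using hom_zero[OF vec_vs vec_vs, of "\<lambda>v. fst (L j) *\<^sub>v v"]
    hom_zero[OF vec_vs vec_vs, of "\<lambda>v. snd (L j) *\<^sub>v v"] krep_L[OF assms]
  by (auto simp: fin_dim_krep_iff mat_krep_simps module_vec_simps)

text \<open>Both sides have the same coordinates, namely the image of \<open>v\<close> under the
  matrix at index \<open>j\<close> and 0 elsewhere, and coordinates separate points.\<close>

lemma e_krep:
  assumes j: "j \<in> J"
  shows "(e1 j, e2 j) \<in> krep_hom (mat_krep (L j)) M"
proof -
  have "e2 j (fst (L j) *\<^sub>v v) = arr_a M (e1 j v)" "e2 j (snd (L j) *\<^sub>v v) = arr_b M (e1 j v)"
    if v: "v \<in> carrier_vec (dim_col (fst (L j)))" for v
  proof -
    have Lv: "fst (L j) *\<^sub>v v \<in> carrier_vec (dim_row (fst (L j)))"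
      "snd (L j) *\<^sub>v v \<in> carrier_vec (dim_row (fst (L j)))"
      using krep_L[OF j] v
      by (auto simp: fin_dim_krep_iff mat_krep_simps class_module_hom_iff module_vec_simps)
    show "e2 j (fst (L j) *\<^sub>v v) = arr_a M (e1 j v)"
      by (rule v2.sep) (use j v Lv in \<open>auto simp: arr_closed c_arr v1.c_e v2.c_e L_zero\<close>)
    show "e2 j (snd (L j) *\<^sub>v v) = arr_b M (e1 j v)"
      by (rule v2.sep) (use j v Lv in \<open>auto simp: arr_closed c_arr v1.c_e v2.c_e L_zero\<close>)
  qed
  then show ?thesis
    using v1.e_hom[OF j] v2.e_hom[OF j] by (simp add: krep_hom_iff mat_krep_simps module_vec_simps)
qed

lemma e_arr:
  assumes "j \<in> J" "v \<in> carrier_vec (dim_col (fst (L j)))"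
  shows "arr_a M (e1 j v) = e2 j (fst (L j) *\<^sub>v v)" "arr_b M (e1 j v) = e2 j (snd (L j) *\<^sub>v v)"
  using e_krep[OF assms(1)] assms(2) by (auto simp: krep_hom_iff mat_krep_simps module_vec_simps)

lemma arr_vanishing:
  assumes "I \<subseteq> J" "x \<in> v1.vanishing I"
  shows "arr_a M x \<in> v2.vanishing I" "arr_b M x \<in> v2.vanishing I"
  using assms by (auto simp: v1.vanishing_def v2.vanishing_def arr_closed c_arr L_zero subset_iff)

lemma dims_le:
  assumes "j \<in> J"
  shows "dim_col (fst (L j)) \<le> krep_dim1 M" "dim_row (fst (L j)) \<le> krep_dim2 M"
  using v1.dim_le v2.dim_le krep_M assms by (auto simp: krep_dim1_def krep_dim2_def)

lemma kdecomp_sub: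
  assumes I: "I \<subseteq> J"
  shows "kdecomp (krep_sub M (v1.vanishing I) (v2.vanishing I)) (J - I) L c1 e1 c2 e2"
proof (rule kdecomp.intro)
  let ?N = "krep_sub M (v1.vanishing I) (v2.vanishing I)"
  show "fin_dim_krep ?N"
    using v1.submodule_vanishing[OF I] v2.submodule_vanishing[OF I] arr_vanishing[OF I]
    by (rule fin_dim_krep_sub[OF krep])
  show n1: "vdecomp (V1 ?N) (J - I) (\<lambda>j. dim_col (fst (L j))) c1 e1"
    using v1.vdecomp_sub[OF I] by simp
  show n2: "vdecomp (V2 ?N) (J - I) (\<lambda>j. dim_row (fst (L j))) c2 e2"
    using v2.vdecomp_sub[OF I] by simp
  show "(c1 j, c2 j) \<in> krep_hom ?N (mat_krep (L j))" if "j \<in> J - I" for j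
    using c_krep[of j] that vdecomp.c_hom[OF n1 that] vdecomp.c_hom[OF n2 that]
    unfolding krep_hom_iff mat_krep_simps by (auto simp: v1.vanishing_def)
qed (use krep_L in auto)

lemma kdecomp_quot:
  assumes I: "I \<subseteq> J"
  shows "kdecomp (krep_quot M (krep_sub M (v1.vanishing I) (v2.vanishing I))) I L
    (\<lambda>j C. the_elem (c1 j ` C)) (\<lambda>j v. v1.vanishing I +>\<^bsub>V1 M\<^esub> e1 j v)
    (\<lambda>j C. the_elem (c2 j ` C)) (\<lambda>j v. v2.vanishing I +>\<^bsub>V2 M\<^esub> e2 j v)"
proof (rule kdecomp.intro)
  let ?N = "krep_quot M (krep_sub M (v1.vanishing I) (v2.vanishing I))"
  note sm = v1.submodule_vanishing[OF I] v2.submodule_vanishing[OF I]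
  show "fin_dim_krep ?N" by (rule fin_dim_krep_quot[OF krep sm arr_vanishing[OF I]])
  show n1: "vdecomp (V1 ?N) I (\<lambda>j. dim_col (fst (L j))) (\<lambda>j C. the_elem (c1 j ` C))
    (\<lambda>j v. v1.vanishing I +>\<^bsub>V1 M\<^esub> e1 j v)"
    using v1.vdecomp_quot[OF I] by (simp add: krep_quot_simps)
  show n2: "vdecomp (V2 ?N) I (\<lambda>j. dim_row (fst (L j))) (\<lambda>j C. the_elem (c2 j ` C))
    (\<lambda>j v. v2.vanishing I +>\<^bsub>V2 M\<^esub> e2 j v)"
    using v2.vdecomp_quot[OF I] by (simp add: krep_quot_simps)
  show "fin_dim_krep (mat_krep (L j))" if "j \<in> I" for j using krep_L that I by auto
  fix j assume j: "j \<in> I"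
  then have jJ: "j \<in> J" using I by auto
  have the1: "the_elem (c1 j ` (v1.vanishing I +>\<^bsub>V1 M\<^esub> x)) = c1 j x" if "x \<in> carrier (V1 M)" for x
    by (rule v1.the_elem_coset[OF I j that])
  have the2: "the_elem (c2 j ` (v2.vanishing I +>\<^bsub>V2 M\<^esub> x)) = c2 j x" if "x \<in> carrier (V2 M)" for x
    by (rule v2.the_elem_coset[OF I j that])
  have carr: "carrier (V1 ?N) = (\<lambda>x. v1.vanishing I +>\<^bsub>V1 M\<^esub> x) ` carrier (V1 M)"
    using module_quot_carrier[OF v1.vs sm(1)] by (simp add: krep_quot_simps)
  note arr = krep_quot_arr[OF krep sm arr_vanishing[OF I], where N = M]
  show "((\<lambda>C. the_elem (c1 j ` C)), (\<lambda>C. the_elem (c2 j ` C))) \<in> krep_hom ?N (mat_krep (L j))"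
    unfolding krep_hom_iff
  proof (intro conjI ballI)
    show "(\<lambda>C. the_elem (c1 j ` C)) \<in> module_hom class_ring (V1 ?N) (V1 (mat_krep (L j)))"
      using vdecomp.c_hom[OF n1 j] by (simp add: mat_krep_simps)
    show "(\<lambda>C. the_elem (c2 j ` C)) \<in> module_hom class_ring (V2 ?N) (V2 (mat_krep (L j)))"
      using vdecomp.c_hom[OF n2 j] by (simp add: mat_krep_simps)
    fix C assume "C \<in> carrier (V1 ?N)"
    then obtain x where x: "x \<in> carrier (V1 M)" "C = v1.vanishing I +>\<^bsub>V1 M\<^esub> x"
      using carr by auto
    show "the_elem (c2 j ` arr_a ?N C) = arr_a (mat_krep (L j)) (the_elem (c1 j ` C))"
      "the_elem (c2 j ` arr_b ?N C) = arr_b (mat_krep (L j)) (the_elem (c1 j ` C))"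
      using x by (simp_all add: arr the1 the2 arr_closed c_arr[OF jJ] mat_krep_simps)
  qed
qed

text \<open>For \<open>j\<close> in \<open>I\<close>, the projection to summand \<open>j\<close>
  followed by an embedding into \<open>U\<close> is a homomorphism that detects coordinate
  \<open>j\<close>. For the other \<open>j\<close>, every homomorphism to \<open>U\<close> dies on
  summand \<open>j\<close>. So the common kernel is cut out by the coordinates in
  \<open>I\<close>.\<close>

lemma reject_eq:
  assumes I: "I \<subseteq> J" and U: "fin_dim_krep U"
    and inj: "\<And>j. j \<in> I \<Longrightarrow> \<exists>(f, g) \<in> krep_hom (mat_krep (L j)) U.
      inj_on f (carrier_vec (dim_col (fst (L j)))) \<and> inj_on g (carrier_vec (dim_row (fst (L j))))"
    and zero: "\<And>j f g. j \<in> J - I \<Longrightarrow> (f, g) \<in> krep_hom (mat_krep (L j)) U \<Longrightarrow>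
      (\<forall>v\<in>carrier_vec (dim_col (fst (L j))). f v = \<zero>\<^bsub>V1 U\<^esub>) \<and>
      (\<forall>v\<in>carrier_vec (dim_row (fst (L j))). g v = \<zero>\<^bsub>V2 U\<^esub>)"
  shows "krep_reject M U = krep_sub M (v1.vanishing I) (v2.vanishing I)"
proof -
  have U': "vectorspace class_ring (V1 U)" "vectorspace class_ring (V2 U)"
    using U by (simp_all add: fin_dim_krep_iff)
  have in1: "x \<in> v1.vanishing I" if x: "x \<in> carrier (V1 M)" and f_zero: "\<forall>(f, g)\<in>krep_hom M U. f x = \<zero>\<^bsub>V1 U\<^esub>" for x
  proof -
    have "c1 j x = 0\<^sub>v (dim_col (fst (L j)))" if j: "j \<in> I" for j
    proof -
      obtain f g where fg: "(f, g) \<in> krep_hom (mat_krep (L j)) U" "inj_on f (carrier_vec (dim_col (fst (L j))))"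
        using inj[OF j] by auto
      have jJ: "j \<in> J" using I j by auto
      have "f (c1 j x) = \<zero>\<^bsub>V1 U\<^esub>" using bspec[OF f_zero krep_hom_comp[OF c_krep[OF jJ] fg(1)]] by simp
      also have "\<dots> = f (0\<^sub>v (dim_col (fst (L j))))"
        using hom_zero[OF vec_vs U'(1), of f] fg(1) by (simp add: krep_hom_iff mat_krep_simps module_vec_simps)
      finally show ?thesis using inj_onD[OF fg(2)] v1.c_closed[OF jJ x] by simp
    qed
    then show ?thesis using x by (simp add: v1.vanishing_def)
  qed
  have in2: "y \<in> v2.vanishing I" if y: "y \<in> carrier (V2 M)" and g_zero: "\<forall>(f, g)\<in>krep_hom M U. g y = \<zero>\<^bsub>V2 U\<^esub>" for y
  proof -
    have "c2 j y = 0\<^sub>v (dim_row (fst (L j)))" if j: "j \<in> I" for j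
    proof -
      obtain f g where fg: "(f, g) \<in> krep_hom (mat_krep (L j)) U" "inj_on g (carrier_vec (dim_row (fst (L j))))"
        using inj[OF j] by auto
      have jJ: "j \<in> J" using I j by auto
      have "g (c2 j y) = \<zero>\<^bsub>V2 U\<^esub>"
        using bspec[OF g_zero krep_hom_comp[OF c_krep[OF jJ] fg(1)]] by simp
      also have "\<dots> = g (0\<^sub>v (dim_row (fst (L j))))"
        using hom_zero[OF vec_vs U'(2), of g] fg(1) by (simp add: krep_hom_iff mat_krep_simps module_vec_simps)
      finally show ?thesis using inj_onD[OF fg(2)] v2.c_closed[OF jJ y] by simp
    qed
    then show ?thesis using y by (simp add: v2.vanishing_def)
  qed
  have zero1: "f x = \<zero>\<^bsub>V1 U\<^esub>" if fg: "(f, g) \<in> krep_hom M U" and x: "x \<in> v1.vanishing I" for f g x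
    using I x U'(1)
  proof (rule v1.hom_vanishes)
    show "f \<in> module_hom class_ring (V1 M) (V1 U)" using fg by (simp add: krep_hom_iff)
    show "f (e1 j v) = \<zero>\<^bsub>V1 U\<^esub>" if "j \<in> J - I" "v \<in> carrier_vec (dim_col (fst (L j)))" for j v
      using zero[OF that(1) krep_hom_comp[OF e_krep fg]] that by auto
  qed
  have zero2: "g y = \<zero>\<^bsub>V2 U\<^esub>" if fg: "(f, g) \<in> krep_hom M U" and y: "y \<in> v2.vanishing I" for f g y
    using I y U'(2)
  proof (rule v2.hom_vanishes)
    show "g \<in> module_hom class_ring (V2 M) (V2 U)" using fg by (simp add: krep_hom_iff)
    show "g (e2 j v) = \<zero>\<^bsub>V2 U\<^esub>" if "j \<in> J - I" "v \<in> carrier_vec (dim_row (fst (L j)))" for j v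
      using zero[OF that(1) krep_hom_comp[OF e_krep fg]] that by auto
  qed
  have "{x \<in> carrier (V1 M). \<forall>(f, g) \<in> krep_hom M U. f x = \<zero>\<^bsub>V1 U\<^esub>} = v1.vanishing I"
  proof (intro equalityI subsetI)
    show "x \<in> {x \<in> carrier (V1 M). \<forall>(f, g) \<in> krep_hom M U. f x = \<zero>\<^bsub>V1 U\<^esub>}"
      if "x \<in> v1.vanishing I" for x
      using zero1[OF _ that] that by (auto simp: v1.vanishing_def)
  qed (rule in1, simp_all)
  moreover have "{y \<in> carrier (V2 M). \<forall>(f, g) \<in> krep_hom M U. g y = \<zero>\<^bsub>V2 U\<^esub>} = v2.vanishing I"
  proof (intro equalityI subsetI)
    show "y \<in> {y \<in> carrier (V2 M). \<forall>(f, g) \<in> krep_hom M U. g y = \<zero>\<^bsub>V2 U\<^esub>}"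
      if "y \<in> v2.vanishing I" for y
      using zero2[OF _ that] that by (auto simp: v2.vanishing_def)
  qed (rule in2, simp_all)
  ultimately show ?thesis unfolding krep_reject_def by simp
qed

text \<open>Dual to \<open>reject_eq\<close>: a surjection from \<open>U\<close> to summand
  \<open>j\<close>, followed by the inclusion, puts that summand into the trace. The roles of the
  index sets are exchanged: \<open>I\<close> now collects the summands that receive no nonzero map
  from \<open>U\<close>, and the trace is the sum of the others.\<close>

lemma trace_eq:
  assumes I: "I \<subseteq> J" and U: "fin_dim_krep U"
    and surj: "\<And>j. j \<in> J - I \<Longrightarrow> \<exists>(f, g) \<in> krep_hom U (mat_krep (L j)).
      f ` carrier (V1 U) = carrier_vec (dim_col (fst (L j))) \<and>
      g ` carrier (V2 U) = carrier_vec (dim_row (fst (L j)))"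
    and zero: "\<And>j f g. j \<in> I \<Longrightarrow> (f, g) \<in> krep_hom U (mat_krep (L j)) \<Longrightarrow>
      (\<forall>v\<in>carrier (V1 U). f v = 0\<^sub>v (dim_col (fst (L j)))) \<and>
      (\<forall>v\<in>carrier (V2 U). g v = 0\<^sub>v (dim_row (fst (L j))))"
  shows "krep_trace M U = krep_sub M (v1.vanishing I) (v2.vanishing I)"
proof -
  let ?A = "\<Union>(f, g) \<in> krep_hom U M. f ` carrier (V1 U)"
  let ?B = "\<Union>(f, g) \<in> krep_hom U M. g ` carrier (V2 U)"
  have sub: "?A \<subseteq> carrier (V1 M)" "?B \<subseteq> carrier (V2 M)" using krep_hom_closed by fast+
  interpret A: submodule class_ring "v1.span ?A" "V1 M" by (rule v1.span_is_submodule[OF sub(1)])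
  interpret B: submodule class_ring "v2.span ?B" "V2 M" by (rule v2.span_is_submodule[OF sub(2)])
  have in_A: "f x \<in> v1.span ?A" if "(f, g) \<in> krep_hom U M" "x \<in> carrier (V1 U)" for f g x
    using v1.in_own_span[OF sub(1)] that by fast
  have in_B: "g x \<in> v2.span ?B" if "(f, g) \<in> krep_hom U M" "x \<in> carrier (V2 U)" for f g x
    using v2.in_own_span[OF sub(2)] that by fast
  have A: "x \<in> v1.span ?A" if "x \<in> v1.vanishing I" for x
    using I that
  proof (induct rule: v1.vanishing_induct)
    case (emb j v)
    obtain f g where fg: "(f, g) \<in> krep_hom U (mat_krep (L j))"
      "f ` carrier (V1 U) = carrier_vec (dim_col (fst (L j)))" using surj[OF emb(1)] by auto
    then obtain u where u: "u \<in> carrier (V1 U)" "v = f u" using emb(2) by (metis imageE)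
    then show ?case using in_A[OF krep_hom_comp[OF fg(1) e_krep] u(1)] emb by auto
  qed auto
  have B: "y \<in> v2.span ?B" if "y \<in> v2.vanishing I" for y
    using I that
  proof (induct rule: v2.vanishing_induct)
    case (emb j v)
    obtain f g where fg: "(f, g) \<in> krep_hom U (mat_krep (L j))"
      "g ` carrier (V2 U) = carrier_vec (dim_row (fst (L j)))" using surj[OF emb(1)] by auto
    then obtain u where u: "u \<in> carrier (V2 U)" "v = g u" using emb(2) by (metis imageE)
    then show ?case using in_B[OF krep_hom_comp[OF fg(1) e_krep] u(1)] emb by auto
  qed auto
  have "v1.span ?A \<subseteq> v1.vanishing I"
  proof (rule v1.span_is_subset[OF _ v1.submodule_vanishing[OF I]])
    have "f x \<in> v1.vanishing I" if "(f, g) \<in> krep_hom U M" "x \<in> carrier (V1 U)" for f g x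
      using zero[OF _ krep_hom_comp[OF that(1) c_krep]] that krep_hom_closed(1)[OF that] I
      by (auto simp: v1.vanishing_def)
    then show "?A \<subseteq> v1.vanishing I" by auto
  qed
  moreover have "v2.span ?B \<subseteq> v2.vanishing I"
  proof (rule v2.span_is_subset[OF _ v2.submodule_vanishing[OF I]])
    have "g x \<in> v2.vanishing I" if "(f, g) \<in> krep_hom U M" "x \<in> carrier (V2 U)" for f g x
      using zero[OF _ krep_hom_comp[OF that(1) c_krep]] that krep_hom_closed(2)[OF that] I
      by (auto simp: v2.vanishing_def)
    then show "?B \<subseteq> v2.vanishing I" by auto
  qed
  ultimately have "v1.span ?A = v1.vanishing I" "v2.span ?B = v2.vanishing I"
    by (auto intro!: equalityI A B)
  then show ?thesis unfolding krep_trace_def by simp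
qed

end


section \<open>Homomorphisms between indecomposables\<close>

lemma kron_P_simps [simp]:
  "dim_row (fst (kron_P n)) = n" "dim_col (fst (kron_P n)) = n - 1"
  "dim_row (snd (kron_P n)) = n" "dim_col (snd (kron_P n)) = n - 1"
  by (simp_all add: kron_P_def)

lemma kron_I_simps [simp]:
  "dim_row (fst (kron_I n)) = n - 1" "dim_col (fst (kron_I n)) = n"
  "dim_row (snd (kron_I n)) = n - 1" "dim_col (snd (kron_I n)) = n"
  by (simp_all add: kron_I_def)

lemma kron_R_simps [simp]:
  "dim_row (fst (kron_R n \<mu>)) = n" "dim_col (fst (kron_R n \<mu>)) = n"
  "dim_row (snd (kron_R n \<mu>)) = n" "dim_col (snd (kron_R n \<mu>)) = n"
  by (cases \<mu>; simp)+

lemma sum_if_eq_mult: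
  "finite A \<Longrightarrow> (\<Sum>j\<in>A. (if i = j then 1 else 0) * f j) = (if i \<in> A then f i else (0::'k::field))"
  by (simp add: if_distrib[where f = "\<lambda>x. x * _"] cong: if_cong)

lemma sum_if_Suc_eq_mult:
  "finite A \<Longrightarrow> (\<Sum>j\<in>A. (if i = Suc j then 1 else 0) * f j) =
    (if 0 < i \<and> i - 1 \<in> A then f (i - 1) else (0::'k::field))"
  by (cases i) (simp_all add: if_distrib[where f = "\<lambda>x. x * _"] cong: if_cong)

lemma kron_P_mult:
  assumes "v \<in> carrier_vec (n - 1)"
  shows "fst (kron_P n) *\<^sub>v v = vec n (\<lambda>i. if i < n - 1 then v $ i else (0::'k::field))"
    "snd (kron_P n) *\<^sub>v v = vec n (\<lambda>i. if i = 0 then 0 else v $ (i - 1))"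
  using assms
  by (auto simp: kron_P_def scalar_prod_def sum_if_eq_mult sum_if_Suc_eq_mult intro!: eq_vecI)

lemma kron_I_mult:
  assumes "v \<in> carrier_vec n"
  shows "fst (kron_I n) *\<^sub>v v = vec (n - 1) (\<lambda>i. v $ i :: 'k::field)"
    "snd (kron_I n) *\<^sub>v v = vec (n - 1) (\<lambda>i. v $ Suc i)"
  using assms
  by (auto simp: kron_I_def scalar_prod_def sum_if_eq_mult intro!: eq_vecI)

lemma jordan_block_mult:
  assumes "v \<in> carrier_vec n"
  shows "jordan_block n a *\<^sub>v v =
    vec n (\<lambda>i. a * v $ i + (if Suc i < n then v $ Suc i else (0::'k::field)))"
proof (rule eq_vecI)
  fix i assume "i < dim_vec (vec n (\<lambda>i. a * v $ i + (if Suc i < n then v $ Suc i else 0)))"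
  then have i: "i < n" by simp
  have "(jordan_block n a *\<^sub>v v) $ i = (\<Sum>j<n. (if i = j then a else if Suc i = j then 1 else 0) * v $ j)"
    using i assms by (simp add: scalar_prod_def jordan_block_def atLeast0LessThan)
  also have "\<dots> = (\<Sum>j<n. a * ((if i = j then 1 else 0) * v $ j) + (if Suc i = j then 1 else 0) * v $ j)"
    by (intro sum.cong) auto
  also have "\<dots> = a * v $ i + (if Suc i < n then v $ Suc i else 0)"
    using i by (simp only: sum.distrib sum_distrib_left[symmetric] sum_if_eq_mult finite_lessThan) simp
  finally show "(jordan_block n a *\<^sub>v v) $ i =
    vec n (\<lambda>i. a * v $ i + (if Suc i < n then v $ Suc i else 0)) $ i" using i by simp
qed simp

lemma fin_dim_krep_kron [simp]:
  "fin_dim_krep (mat_krep (kron_P n))" "fin_dim_krep (mat_krep (kron_I n))"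
  "fin_dim_krep (mat_krep (kron_R n \<mu>))"
  by (auto intro!: fin_dim_mat_krep carrier_matI)

lemma hom_mat_krep_iff:
  "(f, g) \<in> krep_hom N (mat_krep (X :: 'k::field mat \<times> 'k mat)) \<longleftrightarrow>
    f \<in> module_hom class_ring (V1 N) (module_vec TYPE('k) (dim_col (fst X))) \<and>
    g \<in> module_hom class_ring (V2 N) (module_vec TYPE('k) (dim_row (fst X))) \<and>
    (\<forall>x\<in>carrier (V1 N). g (arr_a N x) = fst X *\<^sub>v f x \<and> g (arr_b N x) = snd X *\<^sub>v f x)"
  by (simp add: krep_hom_iff mat_krep_simps)

lemma mat_krep_hom_iff:
  "(f, g) \<in> krep_hom (mat_krep (X :: 'k::field mat \<times> 'k mat)) N \<longleftrightarrow>
    f \<in> module_hom class_ring (module_vec TYPE('k) (dim_col (fst X))) (V1 N) \<and>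
    g \<in> module_hom class_ring (module_vec TYPE('k) (dim_row (fst X))) (V2 N) \<and>
    (\<forall>v\<in>carrier_vec (dim_col (fst X)). g (fst X *\<^sub>v v) = arr_a N (f v) \<and> g (snd X *\<^sub>v v) = arr_b N (f v))"
  by (simp add: krep_hom_iff mat_krep_simps module_vec_simps)

lemma module_hom_vec_closed:
  "f \<in> module_hom class_ring V (module_vec TYPE('k::field) n) \<Longrightarrow> x \<in> carrier V \<Longrightarrow> f x \<in> carrier_vec n"
  by (auto simp: class_module_hom_iff module_vec_simps)

section \<open>Vanishing of homomorphisms into P_n and R_n(\<infinity>) and out of I_n\<close>

lemma hom_to_P_zero_a:
  assumes N: "fin_dim_krep N" and surj: "carrier (V2 N) \<subseteq> arr_a N ` carrier (V1 N)"
    and fg: "(f, g) \<in> krep_hom N (mat_krep (kron_P n :: 'k::field mat \<times> 'k mat))"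
  shows "x \<in> carrier (V1 N) \<Longrightarrow> f x = 0\<^sub>v (n - 1)" "y \<in> carrier (V2 N) \<Longrightarrow> g y = 0\<^sub>v n"
proof -
  have f: "f x \<in> carrier_vec (n - 1)" if "x \<in> carrier (V1 N)" for x
    using fg that by (auto simp: hom_mat_krep_iff intro: module_hom_vec_closed)
  have arr: "g (arr_a N x) = vec n (\<lambda>i. if i < n - 1 then f x $ i else 0)"
    "g (arr_b N x) = vec n (\<lambda>i. if i = 0 then 0 else f x $ (i - 1))" if "x \<in> carrier (V1 N)" for x
    using fg that kron_P_mult[OF f[OF that]] by (auto simp: hom_mat_krep_iff)
  \<comment> \<open>If \<open>\<alpha> x' = \<beta> x\<close>, comparing row \<open>i + 1\<close> of \<open>g (\<alpha> x')\<close> and \<open>g (\<beta> x)\<close> gives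
    \<open>(f x)\<^sub>i = (f x')\<^sub>i\<^sub>+\<^sub>1\<close>, and the last entry of \<open>f x\<close> is \<open>0\<close>.\<close>
  have zero: "f x $ i = 0" if "x \<in> carrier (V1 N)" "n - 1 = Suc (i + k)" for x i k
    using that
  proof (induct k arbitrary: x i)
    case (0 x i)
    have "arr_b N x \<in> carrier (V2 N)" using N 0 by (auto simp: fin_dim_krep_iff class_module_hom_iff)
    then obtain x' where x': "x' \<in> carrier (V1 N)" "arr_b N x = arr_a N x'" using surj by blast
    then have "g (arr_b N x) $ Suc i = g (arr_a N x') $ Suc i" by simp
    then show ?case using 0 x'(1) by (simp add: arr)
  next
    case (Suc k x i)
    have "arr_b N x \<in> carrier (V2 N)" using N Suc by (auto simp: fin_dim_krep_iff class_module_hom_iff)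
    then obtain x' where x': "x' \<in> carrier (V1 N)" "arr_b N x = arr_a N x'" using surj by blast
    then have "g (arr_b N x) $ Suc i = g (arr_a N x') $ Suc i" by simp
    then show ?case using Suc x'(1) by (simp add: arr)
  qed
  show f0: "f x = 0\<^sub>v (n - 1)" if "x \<in> carrier (V1 N)" for x
  proof (rule eq_vecI)
    fix i assume "i < dim_vec (0\<^sub>v (n - 1) :: 'k vec)"
    then show "f x $ i = 0\<^sub>v (n - 1) $ i" using zero[OF that, of i "n - 1 - Suc i"] by simp
  qed (use f[OF that] in simp)
  show "g y = 0\<^sub>v n" if "y \<in> carrier (V2 N)" for y
  proof -
    obtain x where "x \<in> carrier (V1 N)" "y = arr_a N x" using surj \<open>y \<in> _\<close> by blast
    then show ?thesis using f0 by (auto simp: arr)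
  qed
qed

lemma hom_to_P_zero_b:
  assumes N: "fin_dim_krep N" and surj: "carrier (V2 N) \<subseteq> arr_b N ` carrier (V1 N)"
    and fg: "(f, g) \<in> krep_hom N (mat_krep (kron_P n :: 'k::field mat \<times> 'k mat))"
  shows "x \<in> carrier (V1 N) \<Longrightarrow> f x = 0\<^sub>v (n - 1)" "y \<in> carrier (V2 N) \<Longrightarrow> g y = 0\<^sub>v n"
proof -
  have f: "f x \<in> carrier_vec (n - 1)" if "x \<in> carrier (V1 N)" for x
    using fg that by (auto simp: hom_mat_krep_iff intro: module_hom_vec_closed)
  have arr: "g (arr_a N x) = vec n (\<lambda>i. if i < n - 1 then f x $ i else 0)"
    "g (arr_b N x) = vec n (\<lambda>i. if i = 0 then 0 else f x $ (i - 1))" if "x \<in> carrier (V1 N)" for x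
    using fg that kron_P_mult[OF f[OF that]] by (auto simp: hom_mat_krep_iff)
  \<comment> \<open>Now \<alpha> x = \<beta> x', and the induction runs upwards from the first
    entry: row 0 of \<open>g\<close> at \<beta> x' is 0, and row i + 1 identifies entry i + 1 of
    \<open>f x\<close> with entry i of \<open>f x'\<close>.\<close>
  have zero: "f x $ i = 0" if "x \<in> carrier (V1 N)" "i < n - 1" for x i
    using that
  proof (induct i arbitrary: x)
    case (0 x)
    have "arr_a N x \<in> carrier (V2 N)" using N 0 by (auto simp: fin_dim_krep_iff class_module_hom_iff)
    then obtain x' where x': "x' \<in> carrier (V1 N)" "arr_a N x = arr_b N x'" using surj by blast
    then have "g (arr_a N x) $ 0 = g (arr_b N x') $ 0" by simp
    then show ?case using 0 x'(1) by (simp add: arr)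
  next
    case (Suc i x)
    have "arr_a N x \<in> carrier (V2 N)" using N Suc by (auto simp: fin_dim_krep_iff class_module_hom_iff)
    then obtain x' where x': "x' \<in> carrier (V1 N)" "arr_a N x = arr_b N x'" using surj by blast
    then have "g (arr_a N x) $ Suc i = g (arr_b N x') $ Suc i" by simp
    then show ?case using Suc x'(1) by (simp add: arr)
  qed
  show f0: "f x = 0\<^sub>v (n - 1)" if "x \<in> carrier (V1 N)" for x
  proof (rule eq_vecI)
    fix i assume "i < dim_vec (0\<^sub>v (n - 1) :: 'k vec)"
    then show "f x $ i = 0\<^sub>v (n - 1) $ i" using zero[OF that, of i] by simp
  qed (use f[OF that] in simp)
  show "g y = 0\<^sub>v n" if "y \<in> carrier (V2 N)" for y
  proof -
    obtain x where "x \<in> carrier (V1 N)" "y = arr_b N x" using surj \<open>y \<in> _\<close> by blast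
    then show ?thesis using f0 by (auto simp: arr)
  qed
qed

lemma hom_to_R_infinity_zero:
  assumes N: "fin_dim_krep N" and surj: "carrier (V2 N) \<subseteq> arr_a N ` carrier (V1 N)"
    and fg: "(f, g) \<in> krep_hom N (mat_krep (kron_R n (None :: 'k::field option)))"
  shows "x \<in> carrier (V1 N) \<Longrightarrow> f x = 0\<^sub>v n" "y \<in> carrier (V2 N) \<Longrightarrow> g y = 0\<^sub>v n"
proof -
  have f: "f x \<in> carrier_vec n" if "x \<in> carrier (V1 N)" for x
    using fg that by (auto simp: hom_mat_krep_iff intro: module_hom_vec_closed)
  have arr: "g (arr_a N x) = vec n (\<lambda>i. if Suc i < n then f x $ Suc i else 0)" "g (arr_b N x) = f x"
    if "x \<in> carrier (V1 N)" for x
    using fg that f[OF that] jordan_block_mult[OF f[OF that], of 0] by (auto simp: hom_mat_krep_iff)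
  \<comment> \<open>As \<beta> is the identity on R_n(\<infinity>), choosing x' with \<beta> x =
    \<alpha> x' makes \<open>f x\<close> the image of \<open>f x'\<close> under the nilpotent Jordan
    cell. Its last entry is 0, and each earlier entry is the next entry of \<open>f x'\<close>;
    \<open>k\<close> is the distance to the last index.\<close>
  have zero: "f x $ i = 0" if "x \<in> carrier (V1 N)" "n = Suc (i + k)" for x i k
    using that
  proof (induct k arbitrary: x i)
    case (0 x i)
    have "arr_b N x \<in> carrier (V2 N)" using N 0 by (auto simp: fin_dim_krep_iff class_module_hom_iff)
    then obtain x' where x': "x' \<in> carrier (V1 N)" "arr_b N x = arr_a N x'" using surj by blast
    then have "g (arr_b N x) $ i = g (arr_a N x') $ i" by simp
    then show ?case using 0 x'(1) by (simp add: arr)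
  next
    case (Suc k x i)
    have "arr_b N x \<in> carrier (V2 N)" using N Suc by (auto simp: fin_dim_krep_iff class_module_hom_iff)
    then obtain x' where x': "x' \<in> carrier (V1 N)" "arr_b N x = arr_a N x'" using surj by blast
    then have "g (arr_b N x) $ i = g (arr_a N x') $ i" by simp
    then show ?case using Suc x'(1) by (simp add: arr)
  qed
  show f0: "f x = 0\<^sub>v n" if "x \<in> carrier (V1 N)" for x
  proof (rule eq_vecI)
    fix i assume "i < dim_vec (0\<^sub>v n :: 'k vec)"
    then show "f x $ i = 0\<^sub>v n $ i" using zero[OF that, of i "n - Suc i"] by simp
  qed (use f[OF that] in simp)
  show "g y = 0\<^sub>v n" if "y \<in> carrier (V2 N)" for y
  proof -
    obtain x where "x \<in> carrier (V1 N)" "y = arr_a N x" using surj \<open>y \<in> _\<close> by blast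
    then show ?thesis using f0 by (auto simp: arr)
  qed
qed

lemma hom_from_I_zero_a:
  assumes N: "fin_dim_krep N" and inj: "inj_on (arr_a N) (carrier (V1 N))"
    and fg: "(f, g) \<in> krep_hom (mat_krep (kron_I n :: 'k::field mat \<times> 'k mat)) N"
  shows "v \<in> carrier_vec n \<Longrightarrow> f v = \<zero>\<^bsub>V1 N\<^esub>" "w \<in> carrier_vec (n - 1) \<Longrightarrow> g w = \<zero>\<^bsub>V2 N\<^esub>"
proof -
  have vs: "vectorspace class_ring (V1 N)" "vectorspace class_ring (V2 N)" using N by (simp_all add: fin_dim_krep_iff)
  interpret V1: vectorspace class_ring "V1 N" by (rule vs)
  have f: "f v \<in> carrier (V1 N)" if "v \<in> carrier_vec n" for v
    using fg that by (auto simp: mat_krep_hom_iff class_module_hom_iff module_vec_simps)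
  have arr: "g (fst (kron_I n) *\<^sub>v v) = arr_a N (f v)" "g (snd (kron_I n) *\<^sub>v v) = arr_b N (f v)"
    if "v \<in> carrier_vec n" for v using fg that by (auto simp: mat_krep_hom_iff)
  have arr0: "arr_a N \<zero>\<^bsub>V1 N\<^esub> = \<zero>\<^bsub>V2 N\<^esub>" "arr_b N \<zero>\<^bsub>V1 N\<^esub> = \<zero>\<^bsub>V2 N\<^esub>"
    using N by (auto simp: fin_dim_krep_iff intro: hom_zero)
  have f_zero: "f (0\<^sub>v n) = \<zero>\<^bsub>V1 N\<^esub>"
    using hom_zero[OF vec_vs vs(1), of f] fg by (auto simp: mat_krep_hom_iff module_vec_simps)
  \<comment> \<open>\<open>?v\<close> is the downward shift of \<open>v\<close>, chosen so that the second matrix of \<open>I\<^sub>n\<close> maps it to the image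
    of \<open>v\<close> under the first one; iterating the shift reaches \<open>0\<close>.\<close>
  have zero: "f v = \<zero>\<^bsub>V1 N\<^esub>" if "v \<in> carrier_vec n" "\<forall>i<n. i + k < n \<longrightarrow> v $ i = 0" for v k
    using that
  proof (induct k arbitrary: v)
    case (0 v)
    then have "v = 0\<^sub>v n" by (intro eq_vecI) auto
    then show ?case using f_zero by simp
  next
    case (Suc k v)
    let ?v = "vec n (\<lambda>i. if i = 0 then 0 else v $ (i - 1))"
    have "f ?v = \<zero>\<^bsub>V1 N\<^esub>" using Suc(3) by (intro Suc(1)) auto
    moreover have "snd (kron_I n) *\<^sub>v ?v = fst (kron_I n) *\<^sub>v v"
      using Suc(2) by (auto simp: kron_I_mult)
    ultimately have "arr_a N (f v) = arr_a N \<zero>\<^bsub>V1 N\<^esub>"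
      using arr(1)[OF Suc(2)] arr(2)[of ?v] arr0 by simp
    then show ?case using inj_onD[OF inj] f[OF Suc(2)] by simp
  qed
  show f0: "f v = \<zero>\<^bsub>V1 N\<^esub>" if "v \<in> carrier_vec n" for v
    using zero[OF that, of n] by simp
  show "g w = \<zero>\<^bsub>V2 N\<^esub>" if "w \<in> carrier_vec (n - 1)"
  proof -
    let ?v = "vec n (\<lambda>i. if i < n - 1 then w $ i else 0)"
    have "fst (kron_I n) *\<^sub>v ?v = w" using that by (auto simp: kron_I_mult)
    then show ?thesis using arr(1)[of ?v] f0[of ?v] arr0 by simp
  qed
qed

lemma hom_from_I_zero_b:
  assumes N: "fin_dim_krep N" and inj: "inj_on (arr_b N) (carrier (V1 N))"
    and fg: "(f, g) \<in> krep_hom (mat_krep (kron_I n :: 'k::field mat \<times> 'k mat)) N"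
  shows "v \<in> carrier_vec n \<Longrightarrow> f v = \<zero>\<^bsub>V1 N\<^esub>" "w \<in> carrier_vec (n - 1) \<Longrightarrow> g w = \<zero>\<^bsub>V2 N\<^esub>"
proof -
  have vs: "vectorspace class_ring (V1 N)" "vectorspace class_ring (V2 N)" using N by (simp_all add: fin_dim_krep_iff)
  interpret V1: vectorspace class_ring "V1 N" by (rule vs)
  have f: "f v \<in> carrier (V1 N)" if "v \<in> carrier_vec n" for v
    using fg that by (auto simp: mat_krep_hom_iff class_module_hom_iff module_vec_simps)
  have arr: "g (fst (kron_I n) *\<^sub>v v) = arr_a N (f v)" "g (snd (kron_I n) *\<^sub>v v) = arr_b N (f v)"
    if "v \<in> carrier_vec n" for v using fg that by (auto simp: mat_krep_hom_iff)
  have arr0: "arr_a N \<zero>\<^bsub>V1 N\<^esub> = \<zero>\<^bsub>V2 N\<^esub>" "arr_b N \<zero>\<^bsub>V1 N\<^esub> = \<zero>\<^bsub>V2 N\<^esub>"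
    using N by (auto simp: fin_dim_krep_iff intro: hom_zero)
  have f_zero: "f (0\<^sub>v n) = \<zero>\<^bsub>V1 N\<^esub>"
    using hom_zero[OF vec_vs vs(1), of f] fg by (auto simp: mat_krep_hom_iff module_vec_simps)
  \<comment> \<open>The shift goes the other way here: \<open>?v\<close> moves the entries of
    \<open>v\<close> up by one place, so that the first matrix of I_n sends it to the image of
    \<open>v\<close> under the second one. Each shift lowers by one the bound \<open>k\<close> from
    which on the entries vanish.\<close>
  have zero: "f v = \<zero>\<^bsub>V1 N\<^esub>" if "v \<in> carrier_vec n" "\<forall>i<n. k \<le> i \<longrightarrow> v $ i = 0" for v k
    using that
  proof (induct k arbitrary: v)
    case (0 v)
    then have "v = 0\<^sub>v n" by (intro eq_vecI) auto
    then show ?case using f_zero by simp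
  next
    case (Suc k v)
    let ?v = "vec n (\<lambda>i. if Suc i < n then v $ Suc i else 0)"
    have "f ?v = \<zero>\<^bsub>V1 N\<^esub>" using Suc(3) by (intro Suc(1)) auto
    moreover have "fst (kron_I n) *\<^sub>v ?v = snd (kron_I n) *\<^sub>v v"
      using Suc(2) by (auto simp: kron_I_mult)
    ultimately have "arr_b N (f v) = arr_b N \<zero>\<^bsub>V1 N\<^esub>"
      using arr(2)[OF Suc(2)] arr(1)[of ?v] arr0 by simp
    then show ?case using inj_onD[OF inj] f[OF Suc(2)] by simp
  qed
  show f0: "f v = \<zero>\<^bsub>V1 N\<^esub>" if "v \<in> carrier_vec n" for v
    using zero[OF that, of n] by simp
  show "g w = \<zero>\<^bsub>V2 N\<^esub>" if "w \<in> carrier_vec (n - 1)"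
  proof -
    let ?v = "vec n (\<lambda>i. if i < n - 1 then w $ i else 0)"
    \<comment> \<open>The first matrix of I_n is onto, so \<open>g\<close> is determined by
      \<open>f\<close> through \<alpha>.\<close>
    have "fst (kron_I n) *\<^sub>v ?v = w" using that by (auto simp: kron_I_mult)
    then show ?thesis using arr(1)[of ?v] f0[of ?v] arr0 by simp
  qed
qed

text \<open>Padding with zeros at the end if the target is larger, truncation if it is smaller. One
  formula thus gives the embeddings of P_i into P_n and of R_i(\<infinity>) into R_n(\<infinity>) as
  well as the surjections from I_n to I_i.\<close>

definition resize_vec :: "nat \<Rightarrow> 'k::field vec \<Rightarrow> 'k vec" where
  "resize_vec m v = vec m (\<lambda>i. if i < dim_vec v then v $ i else 0)"

lemma resize_vec_hom:
  "resize_vec m \<in> module_hom class_ring (module_vec TYPE('k::field) n) (module_vec TYPE('k) m)"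
  by (auto simp: class_module_hom_iff module_vec_simps resize_vec_def intro!: eq_vecI)

lemma resize_vec_resize_vec:
  assumes "v \<in> carrier_vec n" "n \<le> m"
  shows "resize_vec n (resize_vec m v) = v"
  using assms by (auto simp: resize_vec_def)

lemma inj_on_resize_vec: "n \<le> m \<Longrightarrow> inj_on (resize_vec m) (carrier_vec n)"
  by (rule inj_on_inverseI[of _ "resize_vec n"]) (rule resize_vec_resize_vec)

lemma resize_vec_surj:
  assumes "m \<le> n"
  shows "resize_vec m ` carrier_vec n = (carrier_vec m :: 'k::field vec set)"
proof (intro equalityI subsetI)
  fix v :: "'k vec" assume "v \<in> carrier_vec m"
  then have "v = resize_vec m (resize_vec n v)" using assms by (simp add: resize_vec_resize_vec)
  moreover have "resize_vec n v \<in> carrier_vec n" by (simp add: resize_vec_def)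
  ultimately show "v \<in> resize_vec m ` carrier_vec n" by (rule image_eqI)
qed (auto simp: resize_vec_def)

lemma resize_vec_closed: "resize_vec m v \<in> carrier_vec m"
  by (simp add: resize_vec_def)

text \<open>The matrices of P_n append a zero below or above a vector, and padding at the end
  commutes with both.\<close>

lemma resize_P_hom:
  assumes "1 \<le> i" "i \<le> n"
  shows "(resize_vec (n - 1), resize_vec n) \<in>
    krep_hom (mat_krep (kron_P i)) (mat_krep (kron_P n :: 'k::field mat \<times> 'k mat))"
proof -
  \<comment> \<open>Successor form removes the truncated subtractions \<open>i - 1\<close> and
    \<open>n - 1\<close>.\<close>
  obtain i' n' where i': "i = Suc i'" "n = Suc n'" "i' \<le> n'"
    using assms by (cases i; cases n) auto
  have "resize_vec n (fst (kron_P i) *\<^sub>v v) = fst (kron_P n) *\<^sub>v resize_vec (n - 1) v"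
    "resize_vec n (snd (kron_P i) *\<^sub>v v) = snd (kron_P n) *\<^sub>v resize_vec (n - 1) v"
    if v: "v \<in> carrier_vec (i - 1)" for v :: "'k vec"
    unfolding kron_P_mult[OF v] kron_P_mult[OF resize_vec_closed]
    by (rule eq_vecI; use v i' in \<open>simp add: resize_vec_def\<close>; linarith?)+
  then show ?thesis
    unfolding krep_hom_iff mat_krep_simps by (simp add: resize_vec_hom module_vec_simps)
qed

text \<open>The matrices of I_n drop the last or the first entry, and keeping an initial segment,
  one place shorter at the second vertex, commutes with both.\<close>

lemma resize_I_hom:
  assumes "1 \<le> i" "i \<le> n"
  shows "(resize_vec i, resize_vec (i - 1)) \<in>
    krep_hom (mat_krep (kron_I n)) (mat_krep (kron_I i :: 'k::field mat \<times> 'k mat))"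
proof -
  obtain i' n' where i': "i = Suc i'" "n = Suc n'" "i' \<le> n'"
    using assms by (cases i; cases n) auto
  have "resize_vec (i - 1) (fst (kron_I n) *\<^sub>v v) = fst (kron_I i) *\<^sub>v resize_vec i v"
    "resize_vec (i - 1) (snd (kron_I n) *\<^sub>v v) = snd (kron_I i) *\<^sub>v resize_vec i v"
    if v: "v \<in> carrier_vec n" for v :: "'k vec"
    unfolding kron_I_mult[OF v] kron_I_mult[OF resize_vec_closed]
    by (rule eq_vecI; use v i' in \<open>simp add: resize_vec_def\<close>; linarith?)+
  then show ?thesis
    unfolding krep_hom_iff mat_krep_simps by (simp add: resize_vec_hom module_vec_simps)
qed

text \<open>The span of the first \<open>i\<close> unit vectors is invariant under the nilpotent
  Jordan cell of size \<open>n\<close>, which restricts there to the cell of size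
  \<open>i\<close>.\<close>

lemma resize_R_infinity_hom:
  assumes "i \<le> n"
  shows "(resize_vec n, resize_vec n) \<in>
    krep_hom (mat_krep (kron_R i None)) (mat_krep (kron_R n (None :: 'k::field option)))"
proof -
  have "resize_vec n (jordan_block i 0 *\<^sub>v v) = jordan_block n 0 *\<^sub>v resize_vec n v"
    if v: "v \<in> carrier_vec i" for v :: "'k vec"
    unfolding jordan_block_mult[OF v] jordan_block_mult[OF resize_vec_closed]
    by (rule eq_vecI) (use v assms in \<open>simp_all add: resize_vec_def\<close>)
  then show ?thesis
    unfolding krep_hom_iff mat_krep_simps
    by (simp add: resize_vec_hom module_vec_simps resize_vec_closed)
qed


section \<open>Coordinates and matrices from isomorphisms\<close>

text \<open>The map is built from k^n to \<open>W\<close>, where its linearity is that of linear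
  combinations of a basis, and then inverted. The bijection \<open>h\<close> numbers the
  basis.\<close>

lemma module_hom_vec_iso:
  fixes W :: "('k::field, 'w) module"
  assumes W: "vectorspace class_ring W" and fd: "vectorspace.fin_dim class_ring W"
  shows "\<exists>n g. g \<in> module_hom class_ring W (module_vec TYPE('k) n) \<and>
    bij_betw g (carrier W) (carrier_vec n)"
proof -
  interpret W: vectorspace class_ring W by (rule W)
  obtain B where B: "finite B" "W.basis B" using W.finite_basis_exists[OF fd] by blast
  then have BW: "B \<subseteq> carrier W" by (simp add: W.basis_def)
  obtain h where h: "bij_betw h B {..<card B}"
    using ex_bij_betw_finite_nat[OF B(1)] by (auto simp: atLeast0LessThan)
  have h_less: "h b < card B" if "b \<in> B" for b using h that by (auto simp: bij_betw_def)
  define n where "n = card B"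
  define G :: "'k vec \<Rightarrow> 'w" where "G v = W.lincomb (\<lambda>b. v $ h b) B" for v
  have uniq: "\<exists>!a. a \<in> B \<rightarrow>\<^sub>E UNIV \<and> W.lincomb a B = x" if "x \<in> carrier W" for x
    using W.basis_criterion[OF B(1) BW] B(2) that by simp
  \<comment> \<open>Uniqueness of coefficients holds among functions that are extensional on
    \<open>B\<close>; restricting to \<open>B\<close> does not change the linear
    combination.\<close>
  have lc: "W.lincomb (restrict a B) B = W.lincomb a B" for a
    by (rule W.lincomb_cong[OF refl BW]) auto
  have uniq': "a = b"
    if "a \<in> B \<rightarrow>\<^sub>E UNIV" "b \<in> B \<rightarrow>\<^sub>E UNIV" "W.lincomb a B = W.lincomb b B" for a b
  proof -
    have "W.lincomb b B \<in> carrier W" using BW by auto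
    from uniq[OF this] that show ?thesis by blast
  qed
  have G_hom: "G \<in> module_hom class_ring (module_vec TYPE('k) n) W"
    unfolding class_module_hom_iff module_vec_simps
  proof (intro conjI ballI allI)
    show "G \<in> carrier_vec n \<rightarrow> carrier W" using BW by (auto simp: G_def)
    fix v w :: "'k vec" and c assume v: "v \<in> carrier_vec n" and w: "w \<in> carrier_vec n"
    have "G (v + w) = W.lincomb (\<lambda>b. v $ h b \<oplus>\<^bsub>class_ring\<^esub> w $ h b) B"
      unfolding G_def by (rule W.lincomb_cong[OF refl BW]) (use v w h_less n_def in auto)
    then show "G (v + w) = G v \<oplus>\<^bsub>W\<^esub> G w"
      using W.lincomb_sum[OF B(1) BW, of "\<lambda>b. v $ h b" "\<lambda>b. w $ h b"] by (simp add: G_def)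
  next
    fix v :: "'k vec" and c assume v: "v \<in> carrier_vec n"
    have "G (c \<cdot>\<^sub>v v) = W.lincomb (\<lambda>b. c \<otimes>\<^bsub>class_ring\<^esub> v $ h b) B"
      unfolding G_def by (rule W.lincomb_cong[OF refl BW]) (use v h_less n_def in auto)
    then show "G (c \<cdot>\<^sub>v v) = c \<odot>\<^bsub>W\<^esub> G v"
      using W.lincomb_smult[OF BW, of "\<lambda>b. v $ h b" c] by (simp add: G_def)
  qed
  have "bij_betw G (carrier_vec n) (carrier W)"
    unfolding bij_betw_def
  proof
    show "inj_on G (carrier_vec n)"
    proof (rule inj_onI)
      fix v w :: "'k vec" assume v: "v \<in> carrier_vec n" and w: "w \<in> carrier_vec n" and eq: "G v = G w"
      have "restrict (\<lambda>b. v $ h b) B = restrict (\<lambda>b. w $ h b) B"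
        by (rule uniq') (use eq in \<open>simp_all add: G_def lc\<close>)
      then have vw: "v $ h b = w $ h b" if "b \<in> B" for b using that by (metis restrict_apply)
      show "v = w"
      proof (rule eq_vecI)
        fix i assume "i < dim_vec w"
        then obtain b where "b \<in> B" "i = h b" using h w by (auto simp: bij_betw_def n_def)
        then show "v $ i = w $ i" using vw by simp
      qed (use v w in simp)
    qed
    show "G ` carrier_vec n = carrier W"
    proof (intro equalityI subsetI)
      fix x assume "x \<in> carrier W"
      then obtain a where a: "W.lincomb a B = x" using uniq by blast
      have "G (vec n (\<lambda>i. a (inv_into B h i))) = x"
        unfolding G_def a[symmetric]
        by (rule W.lincomb_cong[OF refl BW]) (use h h_less in \<open>auto simp: n_def bij_betw_def\<close>)
      then show "x \<in> G ` carrier_vec n" by force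
    qed (use BW in \<open>auto simp: G_def\<close>)
  qed
  then have "bij_betw G (carrier (module_vec TYPE('k) n)) (carrier W)"
    by (simp add: module_vec_simps)
  from module_hom_inv_into[OF vec_vs G_hom this] bij_betw_inv_into[OF this]
  show ?thesis by (auto simp: module_vec_simps)
qed

lemma module_hom_vec_mat:
  assumes h: "h \<in> module_hom class_ring (module_vec TYPE('k::field) n) (module_vec TYPE('k) m)"
  shows "\<exists>Y\<in>carrier_mat m n. \<forall>v\<in>carrier_vec n. h v = Y *\<^sub>v v"
proof (intro bexI ballI)
  let ?Y = "mat m n (\<lambda>(i, j). h (unit_vec n j) $ i)"
  show "?Y \<in> carrier_mat m n" by simp
  fix v :: "'k vec" assume v: "v \<in> carrier_vec n"
  have h_closed: "h w \<in> carrier_vec m" if "w \<in> carrier_vec n" for w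
    by (rule module_hom_vec_closed[OF h]) (use that in \<open>simp add: module_vec_simps\<close>)
  have h_add: "h (w + u) = h w + h u" if "w \<in> carrier_vec n" "u \<in> carrier_vec n" for w u
    using h that by (simp add: class_module_hom_iff module_vec_simps)
  have h_smult: "h (c \<cdot>\<^sub>v w) = c \<cdot>\<^sub>v h w" if "w \<in> carrier_vec n" for c w
    using h that by (simp add: class_module_hom_iff module_vec_simps)
  \<comment> \<open>\<open>?t k\<close> is \<open>v\<close> with the entries from \<open>k\<close>
    on replaced by 0. Adding one multiple of a unit vector at a time replaces an expansion of
    \<open>v\<close> as a sum of vectors.\<close>
  let ?t = "\<lambda>k. vec n (\<lambda>j. if j < k then v $ j else 0)"
  have "h (?t k) $ i = (\<Sum>j<k. h (unit_vec n j) $ i * v $ j)" if "i < m" "k \<le> n" for i k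
    using that(2)
  proof (induct k)
    case 0
    have "?t 0 = 0 \<cdot>\<^sub>v (0\<^sub>v n)" by auto
    then have "h (?t 0) = 0 \<cdot>\<^sub>v h (0\<^sub>v n)" by (metis h_smult zero_carrier_vec)
    then show ?case using that(1) h_closed[of "0\<^sub>v n"] by simp
  next
    case (Suc k)
    have "?t (Suc k) = ?t k + v $ k \<cdot>\<^sub>v unit_vec n k"
      using Suc(2) by (auto simp: less_Suc_eq intro!: eq_vecI)
    then have "h (?t (Suc k)) = h (?t k) + v $ k \<cdot>\<^sub>v h (unit_vec n k)"
      using h_add[of "?t k" "v $ k \<cdot>\<^sub>v unit_vec n k"] h_smult[of "unit_vec n k"] by simp
    then show ?case
      using Suc that(1) h_closed[of "unit_vec n k"] by (simp add: mult.commute)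
  qed
  from this[of _ n] have "h v $ i = (?Y *\<^sub>v v) $ i" if "i < m" for i
  proof -
    have "?t n = v" using v by auto
    then show ?thesis
      using \<open>\<And>k i. \<lbrakk>i < m; k \<le> n\<rbrakk> \<Longrightarrow> h (?t k) $ i = (\<Sum>j<k. h (unit_vec n j) $ i * v $ j)\<close>[of i n] that v
      by (simp add: scalar_prod_def atLeast0LessThan)
  qed
  then show "h v = ?Y *\<^sub>v v" using h_closed[OF v] by (intro eq_vecI) auto
qed

text \<open>Coordinates are read off after \<phi>, and summands are embedded by pulling back tuples
  with a single nonzero entry. The induction principle comes from finiteness of supports, whatever
  the size of \<open>J\<close>.\<close>

lemma vdecomp_of_iso:
  fixes V :: "('k::field, 'v) module" and J :: "'j set" and n :: "'j \<Rightarrow> nat"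
  defines "D \<equiv> module_dsum J (\<lambda>j. module_vec TYPE('k) (n j))"
  assumes V: "vectorspace class_ring V"
    and \<phi>: "\<phi> \<in> module_hom class_ring V D" and bij: "bij_betw \<phi> (carrier V) (carrier D)"
  defines "single \<equiv> (\<lambda>j v. \<lambda>i\<in>J. if i = j then v else 0\<^sub>v (n i))"
  shows "vdecomp V J n (\<lambda>j x. \<phi> x j) (\<lambda>j v. inv_into (carrier V) \<phi> (single j v))"
proof (rule vdecomp.intro)
  interpret V: vectorspace class_ring V by (rule V)
  let ?\<psi> = "inv_into (carrier V) \<phi>"
  have \<psi>: "?\<psi> \<in> module_hom class_ring D V" by (rule module_hom_inv_into[OF V \<phi> bij])
  have \<psi>\<phi>: "?\<psi> (\<phi> x) = x" if "x \<in> carrier V" for x using bij that by (simp add: bij_betw_def)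
  have \<phi>\<psi>: "\<phi> (?\<psi> y) = y" if "y \<in> carrier D" for y
    using bij that by (simp add: bij_betw_def f_inv_into_f)
  have \<psi>_closed: "?\<psi> y \<in> carrier V" if "y \<in> carrier D" for y
    using \<psi> that by (auto simp: class_module_hom_iff)
  have D_carrier: "carrier D = {x \<in> \<Pi>\<^sub>E i\<in>J. carrier_vec (n i). finite {i \<in> J. x i \<noteq> 0\<^sub>v (n i)}}"
    by (simp add: D_def module_dsum_def module_vec_simps)
  have D_add: "x \<oplus>\<^bsub>D\<^esub> y = (\<lambda>i\<in>J. x i + y i)" and D_smult: "a \<odot>\<^bsub>D\<^esub> x = (\<lambda>i\<in>J. a \<cdot>\<^sub>v x i)" for x y a
    by (simp_all add: D_def module_dsum_def module_vec_simps)
  have \<phi>_closed: "\<phi> x \<in> carrier D" if "x \<in> carrier V" for x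
    using \<phi> that by (auto simp: class_module_hom_iff)
  have single: "single j v \<in> carrier D" if "j \<in> J" "v \<in> carrier_vec (n j)" for j v
  proof -
    have "{i \<in> J. single j v i \<noteq> 0\<^sub>v (n i)} \<subseteq> {j}" by (auto simp: single_def)
    then show ?thesis using that by (auto simp: D_carrier single_def intro: finite_subset)
  qed
  show "vectorspace class_ring V" by (rule V)
  show "(\<lambda>x. \<phi> x j) \<in> module_hom class_ring V (module_vec TYPE('k) (n j))" if "j \<in> J" for j
    using \<phi> that \<phi>_closed unfolding class_module_hom_iff
    by (auto simp: D_add D_smult module_vec_simps D_carrier)
  show "(\<lambda>v. ?\<psi> (single j v)) \<in> module_hom class_ring (module_vec TYPE('k) (n j)) V" if "j \<in> J" for j
  proof (rule module_hom_comp[OF _ \<psi>])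
    show "single j \<in> module_hom class_ring (module_vec TYPE('k) (n j)) D"
      using single[OF that]
      by (auto simp: class_module_hom_iff module_vec_simps D_add D_smult single_def
          intro!: restrict_ext eq_vecI)
  qed
  show "\<phi> (?\<psi> (single j v)) i = (if i = j then v else 0\<^sub>v (n i))"
    if "i \<in> J" "j \<in> J" "v \<in> carrier_vec (n j)" for i j v
    using that by (simp add: \<phi>\<psi> single) (simp add: single_def)
  show "x = y" if xy: "x \<in> carrier V" "y \<in> carrier V" and eq: "\<And>j. j \<in> J \<Longrightarrow> \<phi> x j = \<phi> y j" for x y
  proof -
    have "\<phi> x = \<phi> y"
      using \<phi>_closed[OF xy(1)] \<phi>_closed[OF xy(2)] eq
      by (intro PiE_ext[of _ J "\<lambda>i. carrier_vec (n i)"]) (auto simp: D_carrier)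
    then show ?thesis using \<psi>\<phi> xy by metis
  qed
  show "Q x" if x: "x \<in> carrier V" and zero: "Q \<zero>\<^bsub>V\<^esub>"
    and add: "\<And>x y. x \<in> carrier V \<Longrightarrow> y \<in> carrier V \<Longrightarrow> Q x \<Longrightarrow> Q y \<Longrightarrow> Q (x \<oplus>\<^bsub>V\<^esub> y)"
    and emb: "\<And>j v. j \<in> J \<Longrightarrow> v \<in> carrier_vec (n j) \<Longrightarrow> Q (?\<psi> (single j v))" for Q x
  proof -
    have "Q (?\<psi> y)" if "finite F" "y \<in> carrier D" "{i \<in> J. y i \<noteq> 0\<^sub>v (n i)} \<subseteq> F" for F y
      using that
    proof (induct F arbitrary: y)
      case empty
      have "\<phi> \<zero>\<^bsub>V\<^esub> = 0 \<odot>\<^bsub>D\<^esub> \<phi> \<zero>\<^bsub>V\<^esub>"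
        using \<phi> V.smult_r_null[of 0] by (metis (no_types, lifting) UNIV_I V.M.zero_closed class_module_hom_iff
            partial_object.select_convs(1))
      then have "\<phi> \<zero>\<^bsub>V\<^esub> j = y j" if "j \<in> J" for j
      proof -
        have "\<phi> \<zero>\<^bsub>V\<^esub> j \<in> carrier_vec (n j)" using \<phi>_closed[of "\<zero>\<^bsub>V\<^esub>"] that by (auto simp: D_carrier)
        moreover have "\<phi> \<zero>\<^bsub>V\<^esub> j = 0 \<cdot>\<^sub>v \<phi> \<zero>\<^bsub>V\<^esub> j"
          using arg_cong[OF \<open>\<phi> \<zero>\<^bsub>V\<^esub> = 0 \<odot>\<^bsub>D\<^esub> \<phi> \<zero>\<^bsub>V\<^esub>\<close>, of "\<lambda>x. x j"] that by (simp add: D_smult)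
        moreover have "0 \<cdot>\<^sub>v w = 0\<^sub>v (n j)" if "w \<in> carrier_vec (n j)" for w :: "'k vec"
          using that by auto
        ultimately show ?thesis using empty that by auto
      qed
      then have "\<phi> \<zero>\<^bsub>V\<^esub> = y"
        using \<phi>_closed[of "\<zero>\<^bsub>V\<^esub>"] empty
        by (intro PiE_ext[of _ J "\<lambda>i. carrier_vec (n i)"]) (auto simp: D_carrier)
      then show ?case using zero \<psi>\<phi>[of "\<zero>\<^bsub>V\<^esub>"] by simp
    next
      case (insert j F)
      show ?case
      proof (cases "j \<in> J")
        case False
        then show ?thesis using insert by (intro insert(3)) auto
      next
        case True
        \<comment> \<open>\<open>y\<close> with its entry at \<open>j\<close> erased: its support
          lies in \<open>F\<close>, and adding the single entry back recovers
          \<open>y\<close>.\<close>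
        define z where "z = (\<lambda>i\<in>J. if i = j then 0\<^sub>v (n i) else y i)"
        have yc: "y i \<in> carrier_vec (n i)" if "i \<in> J" for i
          using insert(4) that by (auto simp: D_carrier)
        have "{i \<in> J. z i \<noteq> 0\<^sub>v (n i)} \<subseteq> F" using insert(5) by (auto simp: z_def)
        moreover from this have "finite {i \<in> J. z i \<noteq> 0\<^sub>v (n i)}"
          using insert(1) by (rule finite_subset)
        then have z: "z \<in> carrier D" using yc by (simp add: D_carrier) (simp add: z_def)
        ultimately have "Q (?\<psi> z)" by (intro insert(3))
        moreover have "Q (?\<psi> (single j (y j)))" using emb True yc by blast
        ultimately have "Q (?\<psi> z \<oplus>\<^bsub>V\<^esub> ?\<psi> (single j (y j)))"
          using \<psi>_closed z single[OF True yc[OF True]] by (intro add)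
        then have "Q (?\<psi> (z \<oplus>\<^bsub>D\<^esub> single j (y j)))"
          using \<psi> z single[OF True yc[OF True]] by (simp add: class_module_hom_iff)
        moreover have "y = z \<oplus>\<^bsub>D\<^esub> single j (y j)"
        proof (rule PiE_ext[of _ J "\<lambda>i. carrier_vec (n i)"])
          show "y \<in> (\<Pi>\<^sub>E i\<in>J. carrier_vec (n i))" using insert(4) by (auto simp: D_carrier)
          show "z \<oplus>\<^bsub>D\<^esub> single j (y j) \<in> (\<Pi>\<^sub>E i\<in>J. carrier_vec (n i))"
            using yc by (auto simp: D_add z_def single_def)
          show "y i = (z \<oplus>\<^bsub>D\<^esub> single j (y j)) i" if "i \<in> J" for i
            using yc[OF that] that by (auto simp: D_add z_def single_def)
        qed
        ultimately show ?thesis by metis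
      qed
    qed
    from this[of "{i \<in> J. \<phi> x i \<noteq> 0\<^sub>v (n i)}" "\<phi> x"] show ?thesis
      using \<phi>_closed[OF x] \<psi>\<phi>[OF x] by (auto simp: D_carrier)
  qed
qed

lemma kdecomp_of_iso:
  fixes M :: "('k::field, 'v, 'w) krep"
  assumes M: "fin_dim_krep M" and iso: "krep_iso M (krep_dsum J (\<lambda>j. mat_krep (L j)))"
    and L: "\<And>j. j \<in> J \<Longrightarrow> fin_dim_krep (mat_krep (L j))"
  shows "\<exists>c1 e1 c2 e2. kdecomp M J L c1 e1 c2 e2"
proof -
  let ?D = "krep_dsum J (\<lambda>j. mat_krep (L j))"
  obtain \<phi> \<psi> where hom: "(\<phi>, \<psi>) \<in> krep_hom M ?D"
    and bij: "bij_betw \<phi> (carrier (V1 M)) (carrier (V1 ?D))" "bij_betw \<psi> (carrier (V2 M)) (carrier (V2 ?D))"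
    using iso by (auto simp: krep_iso_def)
  have D: "V1 ?D = module_dsum J (\<lambda>j. module_vec TYPE('k) (dim_col (fst (L j))))"
    "V2 ?D = module_dsum J (\<lambda>j. module_vec TYPE('k) (dim_row (fst (L j))))"
    by (simp_all add: krep_dsum_def mat_krep_simps)
  have v1: "vdecomp (V1 M) J (\<lambda>j. dim_col (fst (L j))) (\<lambda>j x. \<phi> x j) (\<lambda>j v. inv_into (carrier (V1 M)) \<phi>
      (\<lambda>i\<in>J. if i = j then v else 0\<^sub>v (dim_col (fst (L i)))))"
    using M hom bij unfolding krep_hom_iff D fin_dim_krep_iff by (intro vdecomp_of_iso) auto
  have v2: "vdecomp (V2 M) J (\<lambda>j. dim_row (fst (L j))) (\<lambda>j y. \<psi> y j) (\<lambda>j v. inv_into (carrier (V2 M)) \<psi>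
      (\<lambda>i\<in>J. if i = j then v else 0\<^sub>v (dim_row (fst (L i)))))"
    using M hom bij unfolding krep_hom_iff D fin_dim_krep_iff by (intro vdecomp_of_iso) auto
  have "((\<lambda>x. \<phi> x j), (\<lambda>y. \<psi> y j)) \<in> krep_hom M (mat_krep (L j))" if "j \<in> J" for j
    using vdecomp.c_hom[OF v1 that] vdecomp.c_hom[OF v2 that] hom that
    by (simp add: krep_hom_iff mat_krep_simps krep_dsum_def)
  then have "kdecomp M J L (\<lambda>j x. \<phi> x j) (\<lambda>j v. inv_into (carrier (V1 M)) \<phi>
      (\<lambda>i\<in>J. if i = j then v else 0\<^sub>v (dim_col (fst (L i))))) (\<lambda>j y. \<psi> y j) (\<lambda>j v. inv_into (carrier (V2 M)) \<psi>
      (\<lambda>i\<in>J. if i = j then v else 0\<^sub>v (dim_row (fst (L i)))))"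
    using M L v1 v2 by (intro kdecomp.intro)
  then show ?thesis by blast
qed


section \<open>The set of candidates\<close>

declare kron_R.simps [simp del]

text \<open>As \<open>Z\<close> inverts \<open>X\<close>, the equation Z Y v = \<mu> v says the same
  as Y v = \<mu> X v, and the isomorphism turns this into a condition on the arrows of
  \<open>N\<close>. The right-hand side is independent of the matrix form.\<close>

lemma eigenvalue_matrix_form_iff:
  fixes N :: "('k::field, 'v, 'w) krep"
  assumes N: "fin_dim_krep N" and iso: "krep_iso N (mat_krep (X, Y))"
    and X: "X \<in> carrier_mat l l" and Y: "Y \<in> carrier_mat l l" and Z: "Z \<in> carrier_mat l l"
    and XZ: "inverts_mat X Z" "inverts_mat Z X"
  shows "eigenvalue (Z * Y) \<mu> \<longleftrightarrow>
    (\<exists>x\<in>carrier (V1 N). x \<noteq> \<zero>\<^bsub>V1 N\<^esub> \<and> arr_b N x = \<mu> \<odot>\<^bsub>V2 N\<^esub> arr_a N x)"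
proof -
  have vs: "vectorspace class_ring (V1 N)" "vectorspace class_ring (V2 N)"
    using N by (simp_all add: fin_dim_krep_iff)
  interpret V1: vectorspace class_ring "V1 N" by (rule vs)
  interpret V2: vectorspace class_ring "V2 N" by (rule vs)
  obtain f g where fg: "(f, g) \<in> krep_hom N (mat_krep (X, Y))"
    and bij: "bij_betw f (carrier (V1 N)) (carrier_vec l)" "bij_betw g (carrier (V2 N)) (carrier_vec l)"
    using iso X by (auto simp: krep_iso_def mat_krep_simps module_vec_simps)
  have f: "f \<in> module_hom class_ring (V1 N) (module_vec TYPE('k) l)"
    and g: "g \<in> module_hom class_ring (V2 N) (module_vec TYPE('k) l)"
    and arr: "\<And>x. x \<in> carrier (V1 N) \<Longrightarrow> g (arr_a N x) = X *\<^sub>v f x"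
      "\<And>x. x \<in> carrier (V1 N) \<Longrightarrow> g (arr_b N x) = Y *\<^sub>v f x"
    using fg X by (simp_all add: hom_mat_krep_iff)
  have f_closed: "f x \<in> carrier_vec l" if "x \<in> carrier (V1 N)" for x
    by (rule module_hom_vec_closed[OF f that])
  have f_zero: "f \<zero>\<^bsub>V1 N\<^esub> = 0\<^sub>v l" using hom_zero[OF vs(1) vec_vs f] by (simp add: module_vec_simps)
  have g_smult: "g (c \<odot>\<^bsub>V2 N\<^esub> y) = c \<cdot>\<^sub>v g y" if "y \<in> carrier (V2 N)" for c y
    using g that by (simp add: class_module_hom_iff module_vec_simps)
  have arr_closed: "arr_a N x \<in> carrier (V2 N)" "arr_b N x \<in> carrier (V2 N)" if "x \<in> carrier (V1 N)" for x
    using N that by (auto simp: fin_dim_krep_iff class_module_hom_iff)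
  have XZ1: "X * Z = 1\<^sub>m l" "Z * X = 1\<^sub>m l" using XZ X Z by (auto simp: inverts_mat_def)
  show ?thesis
  proof
    assume "eigenvalue (Z * Y) \<mu>"
    then obtain v where v: "v \<in> carrier_vec l" "v \<noteq> 0\<^sub>v l" "Z * Y *\<^sub>v v = \<mu> \<cdot>\<^sub>v v"
      using Z by (auto simp: eigenvalue_def eigenvector_def)
    have "v \<in> f ` carrier (V1 N)" using bij(1) v(1) by (simp add: bij_betw_def)
    then obtain x where x: "x \<in> carrier (V1 N)" "f x = v" by blast
    have Yv: "Y *\<^sub>v v \<in> carrier_vec l" using Y v(1) by auto
    have "Y *\<^sub>v v = (X * Z) *\<^sub>v (Y *\<^sub>v v)" using Yv by (simp add: XZ1)
    also have "\<dots> = X *\<^sub>v (Z * Y *\<^sub>v v)"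
      using X Y Z v(1) Yv by (simp add: assoc_mult_mat_vec[of _ l l _ l])
    also have "\<dots> = \<mu> \<cdot>\<^sub>v (X *\<^sub>v v)" using X v(1) by (simp add: v(3) mult_mat_vec)
    finally have "g (arr_b N x) = g (\<mu> \<odot>\<^bsub>V2 N\<^esub> arr_a N x)"
      using x arr arr_closed[OF x(1)] by (simp add: g_smult)
    then have "arr_b N x = \<mu> \<odot>\<^bsub>V2 N\<^esub> arr_a N x"
      using arr_closed[OF x(1)] bij(2) by (auto simp: bij_betw_def dest: inj_onD)
    then show "\<exists>x\<in>carrier (V1 N). x \<noteq> \<zero>\<^bsub>V1 N\<^esub> \<and> arr_b N x = \<mu> \<odot>\<^bsub>V2 N\<^esub> arr_a N x"
      using x v(2) f_zero by metis
  next
    assume "\<exists>x\<in>carrier (V1 N). x \<noteq> \<zero>\<^bsub>V1 N\<^esub> \<and> arr_b N x = \<mu> \<odot>\<^bsub>V2 N\<^esub> arr_a N x"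
    then obtain x where x: "x \<in> carrier (V1 N)" "x \<noteq> \<zero>\<^bsub>V1 N\<^esub>" "arr_b N x = \<mu> \<odot>\<^bsub>V2 N\<^esub> arr_a N x"
      by blast
    have fx: "f x \<in> carrier_vec l" by (rule f_closed[OF x(1)])
    have "f x \<noteq> 0\<^sub>v l"
      using bij(1) x(1,2) f_zero by (metis V1.M.zero_closed bij_betw_def inj_onD)
    moreover have "Y *\<^sub>v f x = \<mu> \<cdot>\<^sub>v (X *\<^sub>v f x)"
      using arr[OF x(1)] arr_closed[OF x(1)] x(3) by (simp add: g_smult)
    then have "Z * Y *\<^sub>v f x = \<mu> \<cdot>\<^sub>v (Z * X *\<^sub>v f x)"
      using X Y Z fx by (simp add: assoc_mult_mat_vec[of _ l l _ l] mult_mat_vec[of _ l l])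
    ultimately have "eigenvector (Z * Y) (f x) \<mu>" using Z fx by (simp add: eigenvector_def XZ1)
    then show "eigenvalue (Z * Y) \<mu>" by (auto simp: eigenvalue_def)
  qed
qed

lemma fin_dim_fin_reg_part: "fin_dim_krep M \<Longrightarrow> fin_dim_krep (fin_reg_part M)"
  unfolding fin_reg_part_def reg_part_def kron_K_def
  by (intro fin_dim_krep_reject fin_dim_krep_quot_trace) auto

text \<open>If some matrix form exists, every other form has the same eigenvalues, so
  \<open>Lambda M\<close> lies in the root set of a single characteristic polynomial, which is monic
  and hence nonzero.\<close>

lemma finite_Lambda:
  assumes M: "fin_dim_krep M"
  shows "finite (Lambda M)"
proof (cases "Lambda M = {}")
  case False
  let ?N = "fin_reg_part M"
  from False obtain l X Y Z where form: "X \<in> carrier_mat l l" "Y \<in> carrier_mat l l" "Z \<in> carrier_mat l l"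
    "krep_iso ?N (mat_krep (X, Y))" "inverts_mat X Z" "inverts_mat Z X"
    unfolding Lambda_def by blast
  note N = fin_dim_fin_reg_part[OF M]
  have "Lambda M \<subseteq> {\<mu>. eigenvalue (Z * Y) \<mu>}"
  proof
    fix \<mu> assume "\<mu> \<in> Lambda M"
    then obtain l' X' Y' Z' where form':
      "X' \<in> carrier_mat l' l'" "Y' \<in> carrier_mat l' l'" "Z' \<in> carrier_mat l' l'"
      "krep_iso ?N (mat_krep (X', Y'))" "inverts_mat X' Z'" "inverts_mat Z' X'"
      and ev: "eigenvalue (Z' * Y') \<mu>"
      unfolding Lambda_def mem_Collect_eq by (elim exE conjE) (rule that)
    from ev have "eigenvalue (Z * Y) \<mu>"
      unfolding eigenvalue_matrix_form_iff[OF N form'(4,1-3,5,6)]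
        eigenvalue_matrix_form_iff[OF N form(4,1-3,5,6)] .
    then show "\<mu> \<in> {\<mu>. eigenvalue (Z * Y) \<mu>}" by simp
  qed
  moreover have "finite {\<mu>. eigenvalue (Z * Y) \<mu>}"
  proof -
    have ZY: "Z * Y \<in> carrier_mat l l" using form by auto
    have "char_poly (Z * Y) \<noteq> 0" using degree_monic_char_poly[OF ZY] by auto
    then show ?thesis
      using poly_roots_finite by (simp add: eigenvalue_root_char_poly[OF ZY])
  qed
  ultimately show ?thesis by (rule finite_subset)
qed simp

text \<open>Choose coordinates \<open>g\<close> on the second space and transport them to the first
  one along \<alpha>. This turns \<alpha> into the identity matrix and \<beta> into some square
  matrix.\<close>

lemma matrix_form_exists:
  fixes N :: "('k::field, 'v, 'w) krep"
  assumes N: "fin_dim_krep N" and bij: "bij_betw (arr_a N) (carrier (V1 N)) (carrier (V2 N))"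
  shows "\<exists>l Y. Y \<in> carrier_mat l l \<and> krep_iso N (mat_krep (1\<^sub>m l, Y))"
proof -
  have vs: "vectorspace class_ring (V1 N)" "vectorspace class_ring (V2 N)"
    and a: "arr_a N \<in> module_hom class_ring (V1 N) (V2 N)"
    and b: "arr_b N \<in> module_hom class_ring (V1 N) (V2 N)"
    using N by (simp_all add: fin_dim_krep_iff)
  obtain l g where g: "g \<in> module_hom class_ring (V2 N) (module_vec TYPE('k) l)"
    and g_bij: "bij_betw g (carrier (V2 N)) (carrier_vec l)"
    using module_hom_vec_iso[OF vs(2)] N by (auto simp: fin_dim_krep_iff)
  define f where "f = (\<lambda>x. g (arr_a N x))"
  have f: "f \<in> module_hom class_ring (V1 N) (module_vec TYPE('k) l)"
    unfolding f_def by (rule module_hom_comp[OF a g])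
  have f_bij: "bij_betw f (carrier (V1 N)) (carrier_vec l)"
    using bij_betw_trans[OF bij g_bij] by (simp add: f_def comp_def)
  then have "inv_into (carrier (V1 N)) f \<in> module_hom class_ring (module_vec TYPE('k) l) (V1 N)"
    by (intro module_hom_inv_into[OF vs(1) f]) (simp add: module_vec_simps)
  from module_hom_vec_mat[OF module_hom_comp[OF this module_hom_comp[OF b g]]]
  obtain Y where Y: "Y \<in> carrier_mat l l"
    "\<And>v. v \<in> carrier_vec l \<Longrightarrow> g (arr_b N (inv_into (carrier (V1 N)) f v)) = Y *\<^sub>v v"
    by blast
  have "g (arr_b N x) = Y *\<^sub>v f x" if "x \<in> carrier (V1 N)" for x
    using Y(2)[of "f x"] f_bij that by (auto simp: bij_betw_def)
  moreover have "f x \<in> carrier_vec l" if "x \<in> carrier (V1 N)" for x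
    by (rule module_hom_vec_closed[OF f that])
  ultimately have "(f, g) \<in> krep_hom N (mat_krep (1\<^sub>m l, Y))"
    using f g by (simp add: hom_mat_krep_iff) (simp add: f_def)
  then have "krep_iso N (mat_krep (1\<^sub>m l, Y))"
    using f_bij g_bij by (auto simp: krep_iso_def mat_krep_simps module_vec_simps)
  then show ?thesis using Y(1) by blast
qed

lemma in_LambdaI:
  assumes M: "fin_dim_krep M"
    and bij: "bij_betw (arr_a (fin_reg_part M)) (carrier (V1 (fin_reg_part M))) (carrier (V2 (fin_reg_part M)))"
    and x: "x \<in> carrier (V1 (fin_reg_part M))" "x \<noteq> \<zero>\<^bsub>V1 (fin_reg_part M)\<^esub>"
      "arr_b (fin_reg_part M) x = \<mu> \<odot>\<^bsub>V2 (fin_reg_part M)\<^esub> arr_a (fin_reg_part M) x"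
  shows "\<mu> \<in> Lambda M"
proof -
  note N = fin_dim_fin_reg_part[OF M]
  obtain l Y where Y: "Y \<in> carrier_mat l l" "krep_iso (fin_reg_part M) (mat_krep (1\<^sub>m l, Y))"
    using matrix_form_exists[OF N bij] by blast
  have inv: "inverts_mat (1\<^sub>m l) (1\<^sub>m l)" by (simp add: inverts_mat_def)
  have "eigenvalue (1\<^sub>m l * Y) \<mu>"
    using eigenvalue_matrix_form_iff[OF N Y(2) one_carrier_mat Y(1) one_carrier_mat inv inv] x by blast
  then show ?thesis unfolding Lambda_def using Y inv one_carrier_mat by blast
qed

lemma kron_list_cases:
  assumes "L \<in> kron_list"
  obtains (P) n where "1 \<le> n" "L = kron_P n" | (I) n where "1 \<le> n" "L = kron_I n"
    | (R_infinity) n where "1 \<le> n" "L = kron_R n None" | (R) n \<mu> where "1 \<le> n" "L = kron_R n (Some \<mu>)"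
  using assms unfolding kron_list_def by (auto, metis option.exhaust)

lemma fin_dim_kron_list: "L \<in> kron_list \<Longrightarrow> fin_dim_krep (mat_krep L)"
  by (auto elim!: kron_list_cases)

text \<open>Padding with zeros is a right inverse of the first matrix of I_n.\<close>

lemma arr_kron_I_surj:
  "carrier (V2 (mat_krep (kron_I n :: 'k::field mat \<times> 'k mat))) \<subseteq>
    arr_a (mat_krep (kron_I n)) ` carrier (V1 (mat_krep (kron_I n)))"
proof
  fix w :: "'k vec" assume "w \<in> carrier (V2 (mat_krep (kron_I n :: 'k mat \<times> 'k mat)))"
  then have w: "w \<in> carrier_vec (n - 1)" by (simp add: mat_krep_simps module_vec_simps)
  have "w = fst (kron_I n) *\<^sub>v resize_vec n w"
    unfolding kron_I_mult[OF resize_vec_closed] using w by (intro eq_vecI) (auto simp: resize_vec_def)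
  then show "w \<in> arr_a (mat_krep (kron_I n)) ` carrier (V1 (mat_krep (kron_I n)))"
    using resize_vec_closed[of n w] by (auto simp: mat_krep_simps module_vec_simps)
qed

lemma arr_kron_R_id:
  "v \<in> carrier (V1 (mat_krep (kron_R n (Some \<mu>)))) \<Longrightarrow> arr_a (mat_krep (kron_R n (Some \<mu>))) v = v"
  "v \<in> carrier (V1 (mat_krep (kron_R n None))) \<Longrightarrow> arr_b (mat_krep (kron_R n None)) v = v"
  by (simp_all add: mat_krep_simps module_vec_simps kron_R.simps)

lemma kron_R_carriers: "carrier (V2 (mat_krep (kron_R n \<mu>))) = carrier (V1 (mat_krep (kron_R n \<mu>)))"
  by (simp add: mat_krep_simps)

lemma kron_R_finite_bij:
  "inj_on (arr_a (mat_krep (kron_R n (Some \<mu>)))) (carrier (V1 (mat_krep (kron_R n (Some \<mu>)))))"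
  "carrier (V2 (mat_krep (kron_R n (Some \<mu>)))) \<subseteq>
    arr_a (mat_krep (kron_R n (Some \<mu>))) ` carrier (V1 (mat_krep (kron_R n (Some \<mu>))))"
  unfolding kron_R_carriers by (force simp: inj_on_def arr_kron_R_id)+

lemma kron_R_infinity_bij:
  "inj_on (arr_b (mat_krep (kron_R n None))) (carrier (V1 (mat_krep (kron_R n None))))"
  "carrier (V2 (mat_krep (kron_R n None))) \<subseteq>
    arr_b (mat_krep (kron_R n None)) ` carrier (V1 (mat_krep (kron_R n None)))"
  unfolding kron_R_carriers by (force simp: inj_on_def arr_kron_R_id)+

section \<open>The stages of the construction in terms of summands\<close>

context kdecomp
begin

lemma dims_L:
  assumes "j \<in> J"
  shows "L j = kron_P n \<Longrightarrow> n \<le> krep_dim2 M" "L j = kron_I n \<Longrightarrow> n \<le> krep_dim1 M"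
    "L j = kron_R n \<mu> \<Longrightarrow> n \<le> krep_dim1 M"
  using dims_le[OF assms] by simp_all

text \<open>P_n has dimension n at the second vertex, so a summand P_n forces n \<le> d_2 and embeds
  into P_{d_2}; this is why that single module detects all preprojective summands. Among the others,
  R_n(\<infinity>) is excluded through \<beta> and the rest through \<alpha>.\<close>

lemma kron_K_decomp:
  assumes L: "\<And>j. j \<in> J \<Longrightarrow> L j \<in> kron_list"
  shows "kdecomp (kron_K M) (J - {j\<in>J. \<exists>n\<ge>1. L j = kron_P n}) L c1 e1 c2 e2"
proof -
  let ?I = "{j\<in>J. \<exists>n\<ge>1. L j = kron_P n}" and ?U = "mat_krep (kron_P (krep_dim2 M)) :: ('k, 'k vec, 'k vec) krep"
  have "krep_reject M ?U = krep_sub M (v1.vanishing ?I) (v2.vanishing ?I)"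
  proof (rule reject_eq)
    fix j assume "j \<in> ?I"
    then obtain n where n: "j \<in> J" "1 \<le> n" "L j = kron_P n" by auto
    then have le: "n \<le> krep_dim2 M" by (simp add: dims_L)
    with n have "(resize_vec (krep_dim2 M - 1), resize_vec (krep_dim2 M)) \<in> krep_hom (mat_krep (L j)) ?U"
      using resize_P_hom by simp
    with n le show "\<exists>(f, g)\<in>krep_hom (mat_krep (L j)) ?U. inj_on f (carrier_vec (dim_col (fst (L j)))) \<and>
      inj_on g (carrier_vec (dim_row (fst (L j))))"
      by (intro bexI[of _ "(resize_vec (krep_dim2 M - 1), resize_vec (krep_dim2 M))"])
        (auto intro!: inj_on_resize_vec)
  next
    fix j f g assume j: "j \<in> J - ?I" and fg: "(f, g) \<in> krep_hom (mat_krep (L j)) ?U"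
    from j have "L j \<in> kron_list" using L by auto
    then show "(\<forall>v\<in>carrier_vec (dim_col (fst (L j))). f v = \<zero>\<^bsub>V1 ?U\<^esub>) \<and>
      (\<forall>v\<in>carrier_vec (dim_row (fst (L j))). g v = \<zero>\<^bsub>V2 ?U\<^esub>)"
    proof (cases rule: kron_list_cases)
      case (P n)
      then show ?thesis using j by auto
    next
      case (I n)
      then show ?thesis using hom_to_P_zero_a[OF _ arr_kron_I_surj] fg
        by (auto simp: mat_krep_simps module_vec_simps)
    next
      case (R_infinity n)
      then show ?thesis using hom_to_P_zero_b[OF _ kron_R_infinity_bij(2)] fg
        by (auto simp: mat_krep_simps module_vec_simps)
    next
      case (R n \<mu>)
      then show ?thesis using hom_to_P_zero_a[OF _ kron_R_finite_bij(2)] fg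
        by (auto simp: mat_krep_simps module_vec_simps)
    qed
  qed auto
  then show ?thesis using kdecomp_sub[of ?I] by (simp add: kron_K_def)
qed

text \<open>The size \<open>m\<close> is a parameter because the trace is taken in K while its index
  d_1 is a dimension of the original M.\<close>

lemma quot_trace_decomp:
  assumes L: "\<And>j. j \<in> J \<Longrightarrow> L j \<in> kron_list" "\<And>j n. j \<in> J \<Longrightarrow> L j = kron_P n \<Longrightarrow> \<not> 1 \<le> n"
    and m: "\<And>j n. j \<in> J \<Longrightarrow> L j = kron_I n \<Longrightarrow> n \<le> m"
  shows "\<exists>c1 e1 c2 e2. kdecomp (krep_quot M (krep_trace M (mat_krep (kron_I m))))
    (J - {j\<in>J. \<exists>n\<ge>1. L j = kron_I n}) L c1 e1 c2 e2"
proof -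
  let ?I = "J - {j\<in>J. \<exists>n\<ge>1. L j = kron_I n}" and ?U = "mat_krep (kron_I m) :: ('k, 'k vec, 'k vec) krep"
  have "krep_trace M ?U = krep_sub M (v1.vanishing ?I) (v2.vanishing ?I)"
  proof (rule trace_eq)
    fix j assume "j \<in> J - ?I"
    then obtain n where n: "j \<in> J" "1 \<le> n" "L j = kron_I n" by auto
    then have le: "n \<le> m" by (simp add: m)
    with n have "(resize_vec n, resize_vec (n - 1)) \<in> krep_hom ?U (mat_krep (L j))"
      using resize_I_hom by simp
    with n le show "\<exists>(f, g)\<in>krep_hom ?U (mat_krep (L j)).
      f ` carrier (V1 ?U) = carrier_vec (dim_col (fst (L j))) \<and>
      g ` carrier (V2 ?U) = carrier_vec (dim_row (fst (L j)))"
      by (intro bexI[of _ "(resize_vec n, resize_vec (n - 1))"])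
        (auto simp: mat_krep_simps module_vec_simps resize_vec_surj)
  next
    fix j f g assume j: "j \<in> ?I" and fg: "(f, g) \<in> krep_hom ?U (mat_krep (L j))"
    from j have "L j \<in> kron_list" using L by auto
    then show "(\<forall>v\<in>carrier (V1 ?U). f v = 0\<^sub>v (dim_col (fst (L j)))) \<and>
      (\<forall>v\<in>carrier (V2 ?U). g v = 0\<^sub>v (dim_row (fst (L j))))"
    proof (cases rule: kron_list_cases)
      case (P n)
      then show ?thesis using j L(2) by auto
    next
      case (I n)
      then show ?thesis using j by auto
    next
      case (R_infinity n)
      then show ?thesis using hom_from_I_zero_b[OF _ kron_R_infinity_bij(1)] fg
        by (auto simp: mat_krep_simps module_vec_simps)
    next
      case (R n \<mu>)
      then show ?thesis using hom_from_I_zero_a[OF _ kron_R_finite_bij(1)] fg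
        by (auto simp: mat_krep_simps module_vec_simps)
    qed
  qed auto
  then show ?thesis using kdecomp_quot[of ?I] by (simp, blast)
qed

text \<open>Here \<open>M\<close> stands for R_M, so \<open>krep_dim1 M\<close> is the number d, and
  it bounds the size of every summand R_n(\<infinity>).\<close>

lemma reject_R_infinity_decomp:
  assumes L: "\<And>j. j \<in> J \<Longrightarrow> \<exists>n \<mu>. L j = kron_R n \<mu>"
  shows "kdecomp (krep_reject M (mat_krep (kron_R (krep_dim1 M) None)))
    (J - {j\<in>J. \<exists>n. L j = kron_R n None}) L c1 e1 c2 e2"
proof -
  let ?I = "{j\<in>J. \<exists>n. L j = kron_R n None}"
  let ?U = "mat_krep (kron_R (krep_dim1 M) None) :: ('k, 'k vec, 'k vec) krep"
  have "krep_reject M ?U = krep_sub M (v1.vanishing ?I) (v2.vanishing ?I)"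
  proof (rule reject_eq)
    fix j assume "j \<in> ?I"
    then obtain n where n: "j \<in> J" "L j = kron_R n None" by auto
    then have le: "n \<le> krep_dim1 M" by (rule dims_L)
    with n have "(resize_vec (krep_dim1 M), resize_vec (krep_dim1 M)) \<in> krep_hom (mat_krep (L j)) ?U"
      using resize_R_infinity_hom by simp
    with n le show "\<exists>(f, g)\<in>krep_hom (mat_krep (L j)) ?U. inj_on f (carrier_vec (dim_col (fst (L j)))) \<and>
      inj_on g (carrier_vec (dim_row (fst (L j))))"
      by (intro bexI[of _ "(resize_vec (krep_dim1 M), resize_vec (krep_dim1 M))"])
        (auto intro!: inj_on_resize_vec)
  next
    fix j f g assume j: "j \<in> J - ?I" and fg: "(f, g) \<in> krep_hom (mat_krep (L j)) ?U"
    then obtain n \<mu> where "L j = kron_R n (Some \<mu>)" using L[of j] by (metis (mono_tags, lifting) DiffE mem_Collect_eq option.exhaust)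
    then show "(\<forall>v\<in>carrier_vec (dim_col (fst (L j))). f v = \<zero>\<^bsub>V1 ?U\<^esub>) \<and>
      (\<forall>v\<in>carrier_vec (dim_row (fst (L j))). g v = \<zero>\<^bsub>V2 ?U\<^esub>)"
      using hom_to_R_infinity_zero[OF _ kron_R_finite_bij(2)] fg
      by (auto simp: mat_krep_simps module_vec_simps)
  qed auto
  then show ?thesis using kdecomp_sub[of ?I] by (simp del: kron_R.simps)
qed

text \<open>On each summand \<alpha> is an identity matrix. So it preserves coordinates, which gives
  injectivity, and it reaches every embedded summand, which gives surjectivity by induction.\<close>

lemma arr_a_bij:
  assumes L: "\<And>j. j \<in> J \<Longrightarrow> \<exists>n \<mu>. L j = kron_R n (Some \<mu>)"
  shows "bij_betw (arr_a M) (carrier (V1 M)) (carrier (V2 M))"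
  unfolding bij_betw_def
proof
  have square: "dim_row (fst (L j)) = dim_col (fst (L j))" if "j \<in> J" for j
    using L[OF that] by auto
  have id: "fst (L j) *\<^sub>v v = v" if "j \<in> J" "v \<in> carrier_vec (dim_col (fst (L j)))" for j v
    using L[OF that(1)] that(2) by (auto simp: kron_R.simps)
  show "inj_on (arr_a M) (carrier (V1 M))"
  proof (rule inj_onI)
    fix x y assume xy: "x \<in> carrier (V1 M)" "y \<in> carrier (V1 M)" and eq: "arr_a M x = arr_a M y"
    show "x = y"
    proof (rule v1.sep[OF xy])
      show "c1 j x = c1 j y" if "j \<in> J" for j
        using c_arr(1)[OF that xy(1)] c_arr(1)[OF that xy(2)] eq id[OF that] that xy by simp
    qed
  qed
  have "y \<in> arr_a M ` carrier (V1 M)" if "y \<in> carrier (V2 M)" for y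
    using that
  proof (induct rule: v2.induct)
    case zero
    show ?case using hom_zero[OF v1.vs v2.vs krep_M(1)] v1.M.zero_closed by (metis imageI)
  next
    case (add x y)
    then obtain x' y' where "x' \<in> carrier (V1 M)" "x = arr_a M x'" "y' \<in> carrier (V1 M)" "y = arr_a M y'"
      by blast
    then show ?case using krep_M(1) by (intro image_eqI[of _ _ "x' \<oplus>\<^bsub>V1 M\<^esub> y'"]) (auto simp: class_module_hom_iff)
  next
    case (emb j v)
    then have "v \<in> carrier_vec (dim_col (fst (L j)))" using square by simp
    then show ?case
      using e_arr(1)[OF emb(1)] id[OF emb(1)] emb(1) by (intro image_eqI[of _ _ "e1 j v"]) auto
  qed
  then show "arr_a M ` carrier (V1 M) = carrier (V2 M)" using arr_closed by blast
qed

lemma eigenvector_exists: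
  assumes j: "j \<in> J" and L: "L j = kron_R n (Some \<mu>)" and n: "1 \<le> n"
  shows "\<exists>x\<in>carrier (V1 M). x \<noteq> \<zero>\<^bsub>V1 M\<^esub> \<and> arr_b M x = \<mu> \<odot>\<^bsub>V2 M\<^esub> arr_a M x"
proof (intro bexI conjI)
  let ?v = "unit_vec n 0 :: 'k vec"
  have v: "?v \<in> carrier_vec (dim_col (fst (L j)))" using L by simp
  show "e1 j ?v \<in> carrier (V1 M)" by (rule v1.e_closed[OF j v])
  have "c1 j (e1 j ?v) = ?v" using v1.c_e[OF j j v] by simp
  moreover have "c1 j \<zero>\<^bsub>V1 M\<^esub> = 0\<^sub>v n" using v1.c_zero[OF j] L by simp
  moreover have "?v \<noteq> 0\<^sub>v n" using n by (auto dest!: arg_cong[where f = "\<lambda>v. v $ 0"])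
  ultimately show "e1 j ?v \<noteq> \<zero>\<^bsub>V1 M\<^esub>" by metis
  have "jordan_block n \<mu> *\<^sub>v ?v = \<mu> \<cdot>\<^sub>v ?v"
    unfolding jordan_block_mult[OF unit_vec_carrier] by (rule eq_vecI) auto
  then have "arr_b M (e1 j ?v) = e2 j (\<mu> \<cdot>\<^sub>v ?v)" using e_arr(2)[OF j v] L by (simp add: kron_R.simps)
  also have "\<dots> = \<mu> \<odot>\<^bsub>V2 M\<^esub> e2 j ?v"
    using v2.e_hom[OF j] L by (simp add: class_module_hom_iff module_vec_simps)
  also have "e2 j ?v = arr_a M (e1 j ?v)" using e_arr(1)[OF j v] L by (simp add: kron_R.simps)
  finally show "arr_b M (e1 j ?v) = \<mu> \<odot>\<^bsub>V2 M\<^esub> arr_a M (e1 j ?v)" .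
qed

end

lemma supp_subset_S_set:
  fixes M :: "('k::field, 'v, 'w) krep"
  assumes M: "fin_dim_krep M" and d: "is_multiplicity M d"
  shows "kron_supp d \<subseteq> S_set M"
proof
  fix L assume L: "L \<in> kron_supp d"
  define J where "J = {(L, i). L \<in> kron_list \<and> i < d L}"
  \<comment> \<open>\<open>J1\<close>, \<open>J2\<close> and \<open>J3\<close> index the summands
    that survive in K, in R_M and in R'.\<close>
  define J1 where "J1 = J - {j\<in>J. \<exists>n\<ge>1. fst j = kron_P n}"
  define J2 where "J2 = J1 - {j\<in>J1. \<exists>n\<ge>1. fst j = kron_I n}"
  define J3 where "J3 = J2 - {j\<in>J2. \<exists>n. fst j = kron_R n None}"
  \<comment> \<open>A nonzero multiplicity means that copy number 0 of \<open>L\<close> occurs; this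
    copy is followed through the stages.\<close>
  have L_list: "L \<in> kron_list" and L_J: "(L, 0) \<in> J" using L by (auto simp: kron_supp_def J_def)
  have J_list: "fst j \<in> kron_list" if "j \<in> J" for j using that by (auto simp: J_def)
  have "krep_iso M (krep_dsum J (\<lambda>j. mat_krep (fst j)))"
    using d by (simp only: is_multiplicity_def case_prod_beta' J_def)
  then obtain c1 e1 c2 e2 where k0: "kdecomp M J fst c1 e1 c2 e2"
    using kdecomp_of_iso[OF M, of J fst] fin_dim_kron_list[OF J_list] by blast
  have k1: "kdecomp (kron_K M) J1 fst c1 e1 c2 e2"
    unfolding J1_def by (rule kdecomp.kron_K_decomp[OF k0 J_list])
  have "\<exists>c1 e1 c2 e2. kdecomp (reg_part M) J2 fst c1 e1 c2 e2"
    unfolding reg_part_def J2_def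
  proof (rule kdecomp.quot_trace_decomp[OF k1])
    \<comment> \<open>The bound is taken from the decomposition of M itself, since the trace uses
      I_{d_1} with d_1 belonging to M and not to K.\<close>
    show "n \<le> krep_dim1 M" if "j \<in> J1" "fst j = kron_I n" for j n
      using kdecomp.dims_L(2)[OF k0 _ that(2)] that(1) by (simp add: J1_def)
  qed (auto simp: J1_def J_list)
  then obtain c1' e1' c2' e2' where k2: "kdecomp (reg_part M) J2 fst c1' e1' c2' e2'" by blast
  have J2_R: "\<exists>n \<mu>. fst j = kron_R n \<mu>" if "j \<in> J2" for j
  proof -
    have "fst j \<in> kron_list" using that J_list by (simp add: J2_def J1_def)
    then show ?thesis by (cases rule: kron_list_cases) (use that in \<open>auto simp: J2_def J1_def\<close>)
  qed
  have k3: "kdecomp (fin_reg_part M) J3 fst c1' e1' c2' e2'"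
    unfolding fin_reg_part_def reg_size_def J3_def
    by (rule kdecomp.reject_R_infinity_decomp[OF k2 J2_R])
  show "L \<in> S_set M"
  proof (cases "(L, 0) \<in> J2")
    case False
    \<comment> \<open>A label lost on the way to R_M is preprojective or preinjective, and the
      dimensions of M bound its index. For a surviving label the sharper bound d is
      available.\<close>
    then consider n where "1 \<le> n" "L = kron_P n" | n where "1 \<le> n" "L = kron_I n"
      using L_J by (auto simp: J2_def J1_def)
    then show ?thesis
    proof cases
      case 1
      then show ?thesis using kdecomp.dims_L(1)[OF k0 L_J] by (auto simp: S_set_def)
    next
      case 2
      then show ?thesis using kdecomp.dims_L(2)[OF k0 L_J] by (auto simp: S_set_def)
    qed
  next
    case L_J2: True
    have le: "n \<le> reg_size M" if "L = kron_R n \<mu>" for n \<mu>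
      using kdecomp.dims_L(3)[OF k2 L_J2] that by (simp add: reg_size_def)
    from L_list show ?thesis
    proof (cases rule: kron_list_cases)
      case (R_infinity n)
      then show ?thesis using le unfolding S_set_def by blast
    next
      case (R n \<mu>)
      show ?thesis
      proof (cases "(L, 0) \<in> J3")
        case False
        \<comment> \<open>The label then also has the form R_n'(\<infinity>). Instead of refuting
          this by comparing matrices, the candidate with parameter \<infinity> is used; the row
          count gives n' = n and so 1 \<le> n'.\<close>
        then obtain n' where n': "L = kron_R n' None" using L_J2 by (auto simp: J3_def)
        then have "n' = n" using R(2) kron_R_simps(1)[of n' None] kron_R_simps(1)[of n "Some \<mu>"] by simp
        then show ?thesis using n' R(1) le[OF n'] unfolding S_set_def by blast
      next
        case True
        have J3_R: "\<exists>n \<mu>. fst j = kron_R n (Some \<mu>)" if j: "j \<in> J3" for j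
        proof -
          from j have "j \<in> J2" by (simp add: J3_def)
          then obtain n \<nu> where n\<nu>: "fst j = kron_R n \<nu>" using J2_R by blast
          with j have "\<nu> \<noteq> None" by (cases \<nu>) (auto simp: J3_def)
          then obtain \<kappa> where "\<nu> = Some \<kappa>" by blast
          with n\<nu> show ?thesis by blast
        qed
        have "\<mu> \<in> Lambda M"
          using in_LambdaI[OF M kdecomp.arr_a_bij[OF k3 J3_R]]
            kdecomp.eigenvector_exists[OF k3 True, of n \<mu>] R by auto
        then show ?thesis using R le[OF R(2)] unfolding S_set_def by blast
      qed
    qed (use L_J2 in \<open>auto simp: J2_def J1_def\<close>)
  qed
qed

theorem theorem5p5:
  fixes M :: "('k::alg_closed_field, 'v, 'w) krep"
  assumes "fin_dim_krep M"
  shows "finite (S_set M) \<and>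
    (\<forall>d. is_multiplicity M d \<longrightarrow> kron_supp d \<subseteq> S_set M) \<and>
    S_set M \<subseteq> kron_list"
proof (intro conjI allI impI)
  have "S_set M \<subseteq>
    kron_P ` {..krep_dim2 M} \<union> kron_I ` {..krep_dim1 M} \<union>
    (\<Union>k\<le>reg_size M. kron_R k ` (Some ` Lambda M \<union> {None}))"
    unfolding S_set_def by (auto)
  then show "finite (S_set M)"
    by (rule finite_subset) (simp add: finite_Lambda[OF assms])
  show "S_set M \<subseteq> kron_list"
    unfolding S_set_def kron_list_def by blast
  show "kron_supp d \<subseteq> S_set M" if "is_multiplicity M d" for d
    by (rule supp_subset_S_set[OF assms that])
qed

end
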